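(* Let $g=\frac{\sqrt5-1}{2}$. (i) If $\alpha\in(g,1]\cap\mathbb Q$, then $W_\alpha$ is not in $\mathrm{BMO}$. (ii) There exists a sequence $(u_m)_m$ of rational values with $u_m\uparrow 1-g$ as $m\to+\infty$ such that $W_{u_m}$ is not in $\mathrm{BMO}$ (for every $m$).
   Context: For $\alpha\in(0,1]$ put $\bar\alpha=\max(\alpha,1-\alpha)$ and let $[\cdot]$ denote the integer part (floor). The $\alpha$-continued fraction map is $A_\alpha:[0,\bar\alpha]\to[0,\bar\alpha]$, $A_\alpha(0)=0$, $A_\alpha(x)=\left|\frac1x-\left[\frac1x+1-\alpha\right]\right|$ for $x\neq0$. For $x\in\mathbb R\setminus\mathbb Q$ let $x_{\alpha,0}=|x-[x+1-\bar\alpha]|$, $x_{\alpha,n}=A_\alpha^n(x_{\alpha,0})$, $\beta_{\alpha,-1}(x)=1$, and $\beta_{\alpha,n}(x)=x_{\alpha,0}x_{\alpha,1}\cdots x_{\alpha,n}$ for $n\ge0$. The Wilton function is $$W_\alpha(x)=\sum_{j=0}^\infty(-1)^j\beta_{\alpha,j-1}(x)\log\frac{1}{x_{\alpha,j}},$$ which is defined for almost every $x\in\mathbb R$, is $1$-periodic and locally integrable. A locally integrable function $f$ on $\mathbb R$ is in $\mathrm{BMO}$ (bounded mean oscillation) if $\sup_I\frac1{|I|}\int_I|f-f_I|\,dx<\infty$, where $I$ ranges over all bounded intervals of positive length and $f_I=\frac1{|I|}\int_I f\,dx$. *)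

theory Defs
  imports "HOL-Analysis.Analysis"
begin

definition alpha_bar :: "real \<Rightarrow> real" where
  "alpha_bar \<alpha> = max \<alpha> (1 - \<alpha>)"

(* Of interest for 0 < \<alpha> \<le> 1, as a self-map of {0..alpha_bar \<alpha>}. *)
definition cf_map :: "real \<Rightarrow> real \<Rightarrow> real" where
  "cf_map \<alpha> x =
     (if x = 0 then 0 else \<bar>1 / x - of_int \<lfloor>1 / x + 1 - \<alpha>\<rfloor>\<bar>)"

(* The initial point uses alpha_bar \<alpha> where cf_map uses \<alpha>;
   the two differ for \<alpha> < 1/2. *)
definition cf_iter :: "real \<Rightarrow> nat \<Rightarrow> real \<Rightarrow> real" where
  "cf_iter \<alpha> n x = (cf_map \<alpha> ^^ n) \<bar>x - of_int \<lfloor>x + 1 - alpha_bar \<alpha>\<rfloor>\<bar>"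

(* Index shifted by one: cf_beta \<alpha> n is \<beta>_{\<alpha>,n-1}, so the empty
   product cf_beta \<alpha> 0 is \<beta>_{\<alpha>,-1} = 1. *)
definition cf_beta :: "real \<Rightarrow> nat \<Rightarrow> real \<Rightarrow> real" where
  "cf_beta \<alpha> n x = (\<Prod>i<n. cf_iter \<alpha> i x)"

(* Wilton's series converges only for almost every x. On the remaining null set
   (which includes the rationals) suminf gives junk values; these do not
   affect membership in BMO, which is defined with the complete measure lebesgue. *)
definition wilton :: "real \<Rightarrow> real \<Rightarrow> real" where
  "wilton \<alpha> x = (\<Sum>j. (-1) ^ j * cf_beta \<alpha> j x * ln (1 / cf_iter \<alpha> j x))"

definition locally_integrable :: "(real \<Rightarrow> real) \<Rightarrow> bool" where
  "locally_integrable f \<longleftrightarrow> (\<forall>K. compact K \<longrightarrow> set_integrable lebesgue K f)"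

definition average :: "(real \<Rightarrow> real) \<Rightarrow> real set \<Rightarrow> real" where
  "average f I = (LINT x:I|lebesgue. f x) / measure lebesgue I"

definition mean_oscillation :: "(real \<Rightarrow> real) \<Rightarrow> real set \<Rightarrow> real" where
  "mean_oscillation f I = average (\<lambda>x. \<bar>f x - average f I\<bar>) I"

definition BMO :: "(real \<Rightarrow> real) set" where
  "BMO = {f. locally_integrable f \<and>
     bdd_above {mean_oscillation f I | I.
       is_interval I \<and> bounded I \<and> measure lebesgue I > 0}}"

end

theory Submission
  imports Defs
begin

text \<open>
  Write \<open>A\<close> for \<^term>\<open>cf_map \<alpha>\<close>, and \<open>w\<close> for the series as a function of the folded point
  \<open>y = x\<^sub>0\<close>. Peeling off the first term gives \<open>w y = - ln y - y * w (A y)\<close> wherever the series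
  converges. It converges almost everywhere: let \<open>P n\<close> be the product of the first \<open>n\<close> points of the
  orbit of \<open>y\<close>. It decays geometrically, and \<open>P (n + 1) = \<bar>q y - p\<bar>\<close> with integers satisfying
  \<open>\<bar>q\<bar> \<le> 3\<^sup>n / P n\<close>, so for almost every \<open>y\<close> the quotient \<open>P (n + 1) / P n\<close>, which is the next point
  of the orbit, is bounded below by a multiple of a fixed power of \<open>P n\<close> (\<open>negligible_nonsummable\<close>).

  Suppose that \<open>W = wilton \<alpha>\<close> is in BMO. Call \<open>r\<close> tame if the averages of \<open>\<bar>W\<bar>\<close> over the
  intervals centred at \<open>r\<close> stay bounded as the intervals shrink. In BMO it suffices for this that
  the averages of \<open>W\<close> itself over the intervals with one endpoint at \<open>r\<close>, on one fixed side, stay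
  bounded (\<open>BMO_tame\<close>). Since \<open>A\<close> is a Moebius map on some interval to the left of \<open>r\<close>, the functional
  equation carries tameness from \<open>r\<close> to \<open>A r\<close> (\<open>tame_cf_map\<close>). A rational orbit ends at \<open>0\<close>, and
  \<open>0\<close> is not tame because of the term \<open>- ln y\<close> (\<open>not_tame_0\<close>). Hence no rational point of
  \<open>{0..alpha_bar \<alpha>}\<close> is tame (\<open>not_tame_rational\<close>).

  On the other hand, let \<open>a = alpha_bar \<alpha>\<close> and suppose that \<open>w (1 - t) + w t\<close> is bounded for \<open>t\<close> slightly
  above \<open>1 - a\<close>. Then the average of \<open>W\<close> to the left of \<open>a\<close> is, up to a bounded error, minus the average to
  the right of \<open>1 - a\<close>. The folding \<open>x\<^sub>0\<close> identifies the right side of \<open>a\<close> with one of the sides of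
  \<open>1 - a\<close>, and in BMO the averages over adjacent intervals of the same length differ by a bounded amount,
  so the two averages also agree up to a bounded error. Both are then bounded and \<open>a\<close> is tame, which
  is impossible for rational \<open>\<alpha>\<close> (\<open>wilton_notin_BMO\<close>).

  The bound on \<open>w (1 - t) + w t\<close> comes from matching: the orbits of \<open>t\<close> and \<open>1 - t\<close> merge, after
  numbers of steps whose difference is odd, so that the common tail enters with opposite signs. For \<open>\<alpha>\<close> above the
  golden mean one has \<open>A (A (1 - t)) = A t\<close> (\<open>wilton_notin_BMO_gt_golden\<close>). Below \<open>h = (3 - sqrt 5) / 2\<close>,
  which is \<open>1 - g\<close>, take the parameters obtained from \<open>5 / 14\<close> by iterating \<open>z \<mapsto> 1 / (3 - z)\<close>, which increase to \<open>h\<close>.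
  The branch \<open>M z = 3 - 1 / z\<close> of \<open>A\<close> commutes with \<open>N z = (1 - 2 z) / (1 - z)\<close>, both fixing \<open>h\<close>,
  and \<open>A (1 - t) = N t\<close>. So the two orbits run through pairs \<open>z, N z\<close> with the second one step
  behind, until \<open>z\<close> is near \<open>5 / 14\<close>, where two more steps merge them (\<open>matched_near_base\<close>,
  \<open>matched_near_step\<close>).
\<close>

section \<open>Functions of bounded mean oscillation\<close>

lemma BMO_absolutely_integrable:
  assumes "f \<in> BMO" shows "f absolutely_integrable_on {a..b}"
  using assms by (simp add: BMO_def locally_integrable_def)

lemma BMO_integrable:
  assumes "f \<in> BMO"
  shows "f integrable_on {a..b}" "(\<lambda>x. \<bar>f x\<bar>) integrable_on {a..b}" "(\<lambda>x. \<bar>f x - m\<bar>) absolutely_integrable_on {a..b}"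
proof -
  have ai: "f absolutely_integrable_on {a..b}" using BMO_absolutely_integrable[OF assms] .
  show "f integrable_on {a..b}" using ai by (rule set_lebesgue_integral_eq_integral(1))
  show "(\<lambda>x. \<bar>f x\<bar>) integrable_on {a..b}" using set_integrable_abs[OF ai] by (rule set_lebesgue_integral_eq_integral(1))
  have "(\<lambda>x. f x - m) absolutely_integrable_on {a..b}"
    using set_integral_diff(1)[OF ai, of "\<lambda>_. m"] by simp
  then show "(\<lambda>x. \<bar>f x - m\<bar>) absolutely_integrable_on {a..b}" by (rule set_integrable_abs)
qed

lemma BMO_oscillation:
  assumes f: "f \<in> BMO"
  obtains K where "\<And>a b. a < b \<Longrightarrow>
    integral {a..b} (\<lambda>x. \<bar>f x - integral {a..b} f / (b - a)\<bar>) \<le> K * (b - a)"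
proof -
  obtain K where K: "\<And>I. is_interval I \<Longrightarrow> bounded I \<Longrightarrow> measure lebesgue I > 0 \<Longrightarrow> mean_oscillation f I \<le> K"
    using f unfolding BMO_def bdd_above_def by blast
  show thesis
  proof (rule that)
    fix a b :: real assume ab: "a < b"
    have ai: "f absolutely_integrable_on {a..b}" using BMO_absolutely_integrable[OF f] .
    define m where "m = integral {a..b} f / (b - a)"
    have avg: "average f {a..b} = m"
      using ab by (simp add: average_def m_def set_lebesgue_integral_eq_integral[OF ai])
    have "mean_oscillation f {a..b} = integral {a..b} (\<lambda>x. \<bar>f x - m\<bar>) / (b - a)"
      using ab
      unfolding mean_oscillation_def avg unfolding average_def set_lebesgue_integral_eq_integral(2)[OF BMO_integrable(3)[OF f]] by simp
    moreover have "mean_oscillation f {a..b} \<le> K" using ab by (intro K) (auto simp: is_interval_cc)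
    ultimately show "integral {a..b} (\<lambda>x. \<bar>f x - integral {a..b} f / (b - a)\<bar>) \<le> K * (b - a)"
      using ab unfolding m_def[symmetric] by (simp add: pos_divide_le_eq)
  qed
qed

text \<open>
  Both estimates compare \<open>f\<close> with its average over \<open>{c - e..c + e}\<close>; the halves of that interval have
  half its length, hence averages within a bounded distance.
\<close>

lemma BMO_adjacent_intervals:
  assumes f: "f \<in> BMO"
  obtains K where "\<And>c e. e > 0 \<Longrightarrow> \<bar>integral {c - e..c} f - integral {c..c + e} f\<bar> \<le> K * e"
    "\<And>c e. e > 0 \<Longrightarrow> integral {c - e..c + e} (\<lambda>x. \<bar>f x\<bar>) \<le> K * e + \<bar>integral {c - e..c + e} f\<bar>"
proof -
  obtain K0 where K0: "\<And>a b. a < b \<Longrightarrow>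
    integral {a..b} (\<lambda>x. \<bar>f x - integral {a..b} f / (b - a)\<bar>) \<le> K0 * (b - a)"
    using BMO_oscillation[OF f] by blast
  have "\<bar>integral {c - e..c} f - integral {c..c + e} f\<bar> \<le> 2 * K0 * e \<and>
    integral {c - e..c + e} (\<lambda>x. \<bar>f x\<bar>) \<le> 2 * K0 * e + \<bar>integral {c - e..c + e} f\<bar>" if e: "e > 0" for c e
  proof
    define m where "m = integral {c - e..c + e} f / (2 * e)"
    let ?h = "\<lambda>x. f x - m"
    have osc: "integral {c - e..c + e} (\<lambda>x. \<bar>?h x\<bar>) \<le> 2 * K0 * e"
    proof -
      have "(c + e) - (c - e) = 2 * e" by simp
      then show ?thesis using K0[of "c - e" "c + e"] e by (simp add: m_def mult.assoc mult.left_commute)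
    qed
    have fi: "f integrable_on {a..b}" for a b using BMO_integrable(1)[OF f] .
    have hi: "(\<lambda>x. \<bar>?h x\<bar>) integrable_on {a..b}" for a b
      using BMO_integrable(3)[OF f] by (rule set_lebesgue_integral_eq_integral(1))
    have hi': "?h integrable_on {a..b}" for a b using fi by (intro integrable_diff) auto
    have le: "\<bar>integral {a..b} ?h\<bar> \<le> integral {a..b} (\<lambda>x. \<bar>?h x\<bar>)" for a b
      using integral_norm_bound_integral[OF hi'[of a b] hi[of a b]] by simp
    have split: "integral {c - e..c} (\<lambda>x. \<bar>?h x\<bar>) + integral {c..c + e} (\<lambda>x. \<bar>?h x\<bar>) = integral {c - e..c + e} (\<lambda>x. \<bar>?h x\<bar>)"
      using e hi by (intro Henstock_Kurzweil_Integration.integral_combine) auto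
    have "integral {c - e..c} ?h = integral {c - e..c} f - m * e" "integral {c..c + e} ?h = integral {c..c + e} f - m * e"

      using e Henstock_Kurzweil_Integration.integral_diff[OF fi[of "c - e" c] integrable_const_ivl[of m]]
        Henstock_Kurzweil_Integration.integral_diff[OF fi[of c "c + e"] integrable_const_ivl[of m]] by simp_all
    then have "integral {c - e..c} f - integral {c..c + e} f = integral {c - e..c} ?h - integral {c..c + e} ?h" by simp
    then show "\<bar>integral {c - e..c} f - integral {c..c + e} f\<bar> \<le> 2 * K0 * e"
      using le[of "c - e" c] le[of c "c + e"] split osc by linarith
    have fa: "(\<lambda>x. \<bar>f x\<bar>) integrable_on {c - e..c + e}" using BMO_integrable(2)[OF f] .
    have "integral {c - e..c + e} (\<lambda>x. \<bar>f x\<bar>) \<le> integral {c - e..c + e} (\<lambda>x. \<bar>?h x\<bar> + \<bar>m\<bar>)"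
      using fa hi by (intro integral_le integrable_add) auto
    also have "\<dots> = integral {c - e..c + e} (\<lambda>x. \<bar>?h x\<bar>) + \<bar>m\<bar> * (2 * e)"
      using hi e by (subst Henstock_Kurzweil_Integration.integral_add) auto
    also have "\<bar>m\<bar> * (2 * e) = \<bar>integral {c - e..c + e} f\<bar>" using e by (simp add: m_def)
    finally show "integral {c - e..c + e} (\<lambda>x. \<bar>f x\<bar>) \<le> 2 * K0 * e + \<bar>integral {c - e..c + e} f\<bar>" using osc by linarith
  qed
  then show thesis using that[of "2 * K0"] by blast
qed

text \<open>
  The averages of \<open>\<bar>f\<bar>\<close> over the intervals centred at \<open>r\<close> stay bounded as the radius \<open>e\<close> tends to
  \<open>0\<close>. The constant \<open>C\<close> bounds twice these averages.
\<close>

definition tame :: "(real \<Rightarrow> real) \<Rightarrow> real \<Rightarrow> bool" where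
  "tame f r \<longleftrightarrow> (\<exists>C d. d > 0 \<and> (\<forall>e. 0 < e \<and> e < d \<longrightarrow> integral {r - e..r + e} (\<lambda>x. \<bar>f x\<bar>) \<le> C * e))"

text \<open>
  For tameness it is enough to control the signed integral on one side, and the side may vary with
  the length.
\<close>

lemma BMO_tame:
  assumes f: "f \<in> BMO" and d: "d > 0"
    and *: "\<And>e. 0 < e \<Longrightarrow> e < d \<Longrightarrow> \<bar>integral {r - e..r} f\<bar> \<le> C * e \<or> \<bar>integral {r..r + e} f\<bar> \<le> C * e"
  shows "tame f r"
proof -
  obtain K where K: "\<And>c e. e > 0 \<Longrightarrow> \<bar>integral {c - e..c} f - integral {c..c + e} f\<bar> \<le> K * e"
    "\<And>c e. e > 0 \<Longrightarrow> integral {c - e..c + e} (\<lambda>x. \<bar>f x\<bar>) \<le> K * e + \<bar>integral {c - e..c + e} f\<bar>"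
    using BMO_adjacent_intervals[OF f] by blast
  have "integral {r - e..r + e} (\<lambda>x. \<bar>f x\<bar>) \<le> (2 * K + 2 * C) * e" if e: "0 < e" "e < d" for e
  proof -
    have fi: "f integrable_on {a..b}" for a b using BMO_integrable(1)[OF f] .
    have "integral {r - e..r} f + integral {r..r + e} f = integral {r - e..r + e} f"
      using e fi by (intro Henstock_Kurzweil_Integration.integral_combine) auto
    then have "\<bar>integral {r - e..r + e} f\<bar> \<le> K * e + 2 * (C * e)"
      using *[OF e] K(1)[OF e(1), of r] by linarith
    then show ?thesis using K(2)[OF e(1), of r] by (simp add: algebra_simps)
  qed
  then show ?thesis unfolding tame_def using d by blast
qed

lemma tame_subset:
  assumes f: "f \<in> BMO" and "tame f r"
  obtains C d where "d > 0" "\<And>a b e. 0 < e \<Longrightarrow> e < d \<Longrightarrow> r - e \<le> a \<Longrightarrow> b \<le> r + e \<Longrightarrow>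
     integral {a..b} (\<lambda>x. \<bar>f x\<bar>) \<le> C * e"
proof -
  obtain C d where d: "d > 0" "\<And>e. 0 < e \<Longrightarrow> e < d \<Longrightarrow> integral {r - e..r + e} (\<lambda>x. \<bar>f x\<bar>) \<le> C * e"
    using assms(2) unfolding tame_def by blast
  show thesis
  proof (rule that[OF d(1)])
    fix a b e assume e: "0 < e" "e < d" "r - e \<le> a" "b \<le> r + e"
    have fi: "(\<lambda>x. \<bar>f x\<bar>) integrable_on {a..b}" for a b using BMO_integrable(2)[OF f] .
    have "integral {a..b} (\<lambda>x. \<bar>f x\<bar>) \<le> integral {r - e..r + e} (\<lambda>x. \<bar>f x\<bar>)"
      using e fi by (intro integral_subset_le) auto
    then show "integral {a..b} (\<lambda>x. \<bar>f x\<bar>) \<le> C * e" using d(2)[OF e(1,2)] by linarith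
  qed
qed

lemma integral_le_off_negligible:
  fixes f g :: "real \<Rightarrow> real"
  assumes "negligible N" "f integrable_on S" "g integrable_on S" "\<And>x. x \<in> S - N \<Longrightarrow> f x \<le> g x"
  shows "integral S f \<le> integral S g"
proof -
  define h where "h x = (if x \<in> N then g x else f x)" for x
  have "h integrable_on S" by (rule integrable_spike[OF assms(2,1)]) (simp add: h_def)
  then have "integral S h \<le> integral S g" using assms by (intro integral_le) (auto simp: h_def)
  moreover have "integral S h = integral S f" by (rule integral_spike[OF assms(1)]) (simp add: h_def)
  ultimately show ?thesis by simp
qed

lemma absolutely_integrable_substitution:
  fixes f :: "real \<Rightarrow> real"
  assumes "f absolutely_integrable_on g ` {a..b}"
    and "\<And>x. x \<in> {a..b} \<Longrightarrow> (g has_field_derivative g' x) (at x within {a..b})"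
    and "inj_on g {a..b}"
  shows "(\<lambda>x. \<bar>g' x\<bar> * f (g x)) integrable_on {a..b}"
    "integral {a..b} (\<lambda>x. \<bar>g' x\<bar> * f (g x)) = integral (g ` {a..b}) f"
  using has_absolute_integral_change_of_variables_1'[of "{a..b}" g g' f "integral (g ` {a..b}) f"] assms
    set_lebesgue_integral_eq_integral(1)
  by auto

lemma BMO_integral_recentre:
  assumes f: "f \<in> BMO" and e: "0 \<le> e"
  shows "(\<lambda>s. f (c + s)) integrable_on {0..e}" "integral {0..e} (\<lambda>s. f (c + s)) = integral {c..c + e} f"
    "(\<lambda>s. f (c - s)) integrable_on {0..e}" "integral {0..e} (\<lambda>s. f (c - s)) = integral {c - e..c} f"
proof -
  have img: "(\<lambda>s. c + s) ` {0..e} = {c..c + e}" "(\<lambda>s. c - s) ` {0..e} = {c - e..c}"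
    using e by (simp_all add: image_add_atLeastAtMost image_diff_atLeastAtMost)
  have p: "((\<lambda>s. c + s) has_field_derivative 1) (at x within {0..e})"
    and m: "((\<lambda>s. c - s) has_field_derivative -1) (at x within {0..e})" for x
    by (auto intro!: derivative_eq_intros)
  have 1: "f absolutely_integrable_on (\<lambda>s. c + s) ` {0..e}" "f absolutely_integrable_on (\<lambda>s. c - s) ` {0..e}"
    unfolding img by (rule BMO_absolutely_integrable[OF f])+
  have inj: "inj_on (\<lambda>s. c + s) {0..e}" "inj_on (\<lambda>s. c - s) {0..e}" by (auto simp: inj_on_def)
  note subs = absolutely_integrable_substitution[OF 1(1) p inj(1), unfolded img(1) abs_one mult_1]
    absolutely_integrable_substitution[OF 1(2) m inj(2), unfolded img(2) abs_minus_cancel abs_one mult_1]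
  show "(\<lambda>s. f (c + s)) integrable_on {0..e}" by (rule subs(1))
  show "integral {0..e} (\<lambda>s. f (c + s)) = integral {c..c + e} f" by (rule subs(2))
  show "(\<lambda>s. f (c - s)) integrable_on {0..e}" by (rule subs(3))
  show "integral {0..e} (\<lambda>s. f (c - s)) = integral {c - e..c} f" by (rule subs(4))
qed

section \<open>Almost everywhere convergence\<close>

text \<open>
  For each \<open>c\<close> the points described by the inner condition lie in a union of intervals about the
  fractions \<open>p / q\<close> of radius \<open>c / \<bar>q\<bar>\<^sup>3\<close>, with at most \<open>5 \<bar>q\<bar>\<close> numerators for each denominator. The total
  length is at most a constant times \<open>c\<close>.
\<close>

lemma negligible_well_approximable:
  "negligible {x::real. \<forall>c>0. \<exists>q p::int. q \<noteq> 0 \<and> \<bar>p\<bar> \<le> 2 * \<bar>q\<bar> \<and> \<bar>of_int q * x - of_int p\<bar> \<le> c / (of_int q)\<^sup>2}"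
    (is "negligible ?N")
proof (subst negligible_outer_le, intro allI impI)
  fix e :: real assume "e > 0"
  define Z :: real where "Z = (\<Sum>n. 1 / (real n + 1)\<^sup>2)"
  have sm: "summable (\<lambda>n. 1 / (real n + 1)\<^sup>2)"
    using inverse_squares_sums by (simp add: sums_iff add.commute)
  have Zpart: "(\<Sum>i\<in>I. 1 / (real i + 1)\<^sup>2) \<le> Z" if "finite I" for I
    unfolding Z_def by (rule sum_le_suminf[OF sm that]) auto
  have "Z \<ge> 1" using Zpart[of "{0}"] by simp
  define c where "c = e / (10 * Z)"
  have "c > 0" using \<open>e > 0\<close> \<open>Z \<ge> 1\<close> by (simp add: c_def)
  define F where "F n p = cball (of_int p / (real n + 1)) (c / (real n + 1)^3)" for n :: nat and p :: int
  define S where "S n = (\<Union>p\<in>{-2 * (int n + 1)..2 * (int n + 1)}. F n p)" for n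
  have Fm: "F n p \<in> lmeasurable" for n p by (simp add: F_def)
  have Fv: "measure lebesgue (F n p) = 2 * c / (real n + 1)^3" for n p
  proof -
    have "c / (real n + 1)^3 > 0" using \<open>c > 0\<close> by simp
    then show ?thesis
      unfolding F_def cball_eq_atLeastAtMost by simp
  qed
  have Sm: "S n \<in> lmeasurable" for n unfolding S_def using Fm by (intro fmeasurable.finite_UN) auto
  have Sv: "measure lebesgue (S n) \<le> 10 * c / (real n + 1)\<^sup>2" for n
  proof -
    have "measure lebesgue (S n) \<le> (\<Sum>p\<in>{-2 * (int n + 1)..2 * (int n + 1)}. measure lebesgue (F n p))"
      unfolding S_def by (intro measure_UNION_le) (use Fm in auto)
    also have "\<dots> = (4 * (real n + 1) + 1) * (2 * c / (real n + 1)^3)"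
      by (simp add: Fv)
    also have "\<dots> \<le> (5 * (real n + 1)) * (2 * c / (real n + 1)^3)"
      using \<open>c > 0\<close> by (intro mult_right_mono) auto
    also have "\<dots> = 10 * c / (real n + 1)\<^sup>2"
    proof -
      have "real n + 1 \<noteq> 0" by linarith
      then show ?thesis by (simp add: power2_eq_square power3_eq_cube divide_simps)
    qed
    finally show ?thesis .
  qed
  have fin: "measure lebesgue (\<Union>n\<in>I. S n) \<le> e" if "finite I" for I
  proof -
    have "measure lebesgue (\<Union>n\<in>I. S n) \<le> (\<Sum>n\<in>I. measure lebesgue (S n))"
      using that Sm by (intro measure_UNION_le) auto
    also have "\<dots> \<le> (\<Sum>n\<in>I. 10 * c * (1 / (real n + 1)\<^sup>2))"
      using Sv by (intro sum_mono) simp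
    also have "\<dots> = 10 * c * (\<Sum>n\<in>I. 1 / (real n + 1)\<^sup>2)" by (simp add: sum_distrib_left)
    also have "\<dots> \<le> 10 * c * Z" using Zpart[OF that] \<open>c > 0\<close> by (intro mult_left_mono) auto
    also have "\<dots> = e" using \<open>Z \<ge> 1\<close> by (simp add: c_def)
    finally show ?thesis .
  qed
  have "?N \<subseteq> (\<Union>n. S n)"
  proof
    fix x assume "x \<in> ?N"
    then obtain q0 p0 :: int where q0: "q0 \<noteq> 0" "\<bar>p0\<bar> \<le> 2 * \<bar>q0\<bar>" "\<bar>of_int q0 * x - of_int p0\<bar> \<le> c / (of_int q0)\<^sup>2"
      using \<open>c > 0\<close> by blast
    define q p where "q = \<bar>q0\<bar>" and "p = sgn q0 * p0"
    have q: "q > 0" "\<bar>p\<bar> \<le> 2 * q" "\<bar>of_int q * x - of_int p\<bar> \<le> c / (of_int q)\<^sup>2"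
      using q0 unfolding q_def p_def
      by (auto simp: sgn_if abs_mult split: if_splits)
    define n where "n = nat (q - 1)"
    have n: "int n + 1 = q" using q by (simp add: n_def)
    have rn: "real n + 1 = of_int q" using n by (metis of_int_1 of_int_add of_int_of_nat_eq)
    have "\<bar>x - of_int p / of_int q\<bar> = \<bar>of_int q * x - of_int p\<bar> / of_int q"
      using q(1) by (simp add: field_simps abs_if)
    also have "\<dots> \<le> (c / (of_int q)\<^sup>2) / of_int q" using q by (intro divide_right_mono) auto
    also have "\<dots> = c / (of_int q)^3" by (simp add: power2_eq_square power3_eq_cube)
    finally have "x \<in> F n p" by (simp add: F_def rn dist_real_def abs_minus_commute)
    moreover have "p \<in> {-2 * (int n + 1)..2 * (int n + 1)}" using q(2) n by auto
    ultimately show "x \<in> (\<Union>n. S n)" unfolding S_def by blast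
  qed
  moreover have "(\<Union>n. S n) \<in> lmeasurable" "measure lebesgue (\<Union>n. S n) \<le> e"
    using fmeasurable_UN_bound[of UNIV S lebesgue e] measure_UN_bound[of UNIV S lebesgue e] Sm fin by auto
  ultimately show "\<exists>T. ?N \<subseteq> T \<and> T \<in> lmeasurable \<and> measure lebesgue T \<le> e" by blast
qed

text \<open>
  The \<open>n\<close>-th point of the orbit of \<open>y\<close>. While \<^const>\<open>cf_iter\<close> first folds a real number into
  \<open>{0..alpha_bar \<alpha>}\<close>, here and in the next three definitions \<open>y\<close> is the folded point itself.
\<close>

definition cf_orbit :: "real \<Rightarrow> nat \<Rightarrow> real \<Rightarrow> real" where
  "cf_orbit \<alpha> n y = (cf_map \<alpha> ^^ n) y"

text \<open>
  The product of the first \<open>n\<close> points of the orbit, so the empty product for \<open>n = 0\<close>.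
\<close>

definition cf_orbit_prod :: "real \<Rightarrow> nat \<Rightarrow> real \<Rightarrow> real" where
  "cf_orbit_prod \<alpha> n y = (\<Prod>i<n. cf_orbit \<alpha> i y)"

text \<open>
  The \<open>j\<close>-th term of Wilton's series at the folded point \<open>y\<close>.
\<close>

definition wilton_term :: "real \<Rightarrow> real \<Rightarrow> nat \<Rightarrow> real" where
  "wilton_term \<alpha> y j = (-1) ^ j * cf_orbit_prod \<alpha> j y * ln (1 / cf_orbit \<alpha> j y)"

text \<open>
  Wilton's series at the folded point \<open>y\<close>; meaningful only where \<open>summable (wilton_term \<alpha> y)\<close>.
\<close>

definition wilton_series :: "real \<Rightarrow> real \<Rightarrow> real" where
  "wilton_series \<alpha> y = (\<Sum>j. wilton_term \<alpha> y j)"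

lemma cf_orbit_0 [simp]: "cf_orbit \<alpha> 0 y = y" by (simp add: cf_orbit_def)
lemma cf_orbit_Suc: "cf_orbit \<alpha> (Suc n) y = cf_map \<alpha> (cf_orbit \<alpha> n y)" by (simp add: cf_orbit_def)
lemma cf_orbit_Suc': "cf_orbit \<alpha> (Suc n) y = cf_orbit \<alpha> n (cf_map \<alpha> y)" by (simp add: cf_orbit_def funpow_swap1)
lemma cf_orbit_prod_0 [simp]: "cf_orbit_prod \<alpha> 0 y = 1" by (simp add: cf_orbit_prod_def)
lemma cf_orbit_prod_Suc: "cf_orbit_prod \<alpha> (Suc n) y = cf_orbit_prod \<alpha> n y * cf_orbit \<alpha> n y" by (simp add: cf_orbit_prod_def)
lemma cf_orbit_prod_Suc': "cf_orbit_prod \<alpha> (Suc n) y = y * cf_orbit_prod \<alpha> n (cf_map \<alpha> y)"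
  by (simp add: cf_orbit_prod_def prod.lessThan_Suc_shift cf_orbit_Suc' del: prod.lessThan_Suc)

lemma wilton_eq_wilton_series: "wilton \<alpha> x = wilton_series \<alpha> \<bar>x - of_int \<lfloor>x + 1 - alpha_bar \<alpha>\<rfloor>\<bar>"
  by (simp add: wilton_def wilton_series_def wilton_term_def cf_beta_def cf_iter_def cf_orbit_prod_def cf_orbit_def)

lemma alpha_bar_bounds:
  assumes "0 < \<alpha>" "\<alpha> \<le> 1"
  shows "0 < alpha_bar \<alpha>" "alpha_bar \<alpha> \<le> 1" "1 - alpha_bar \<alpha> \<le> \<alpha>" "\<alpha> \<le> alpha_bar \<alpha>" "1 - \<alpha> \<le> alpha_bar \<alpha>"
  using assms by (auto simp: alpha_bar_def max_def)

lemma cf_map_range: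
  assumes "0 < \<alpha>" "\<alpha> \<le> 1"
  shows "0 \<le> cf_map \<alpha> x" "cf_map \<alpha> x \<le> alpha_bar \<alpha>"
proof -
  show "0 \<le> cf_map \<alpha> x" by (simp add: cf_map_def)
  define t n where "t = 1 / x" and "n = \<lfloor>t + 1 - \<alpha>\<rfloor>"
  have "of_int n \<le> t + 1 - \<alpha>" "t + 1 - \<alpha> < of_int n + 1"
    unfolding n_def by linarith+
  then have "\<bar>t - of_int n\<bar> \<le> alpha_bar \<alpha>"
    using alpha_bar_bounds[OF assms] by linarith
  then show "cf_map \<alpha> x \<le> alpha_bar \<alpha>" using alpha_bar_bounds[OF assms]
    by (simp add: cf_map_def t_def n_def)
qed

lemma cf_orbit_range:
  assumes "0 < \<alpha>" "\<alpha> \<le> 1" "0 \<le> y" "y \<le> alpha_bar \<alpha>"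
  shows "0 \<le> cf_orbit \<alpha> n y" "cf_orbit \<alpha> n y \<le> alpha_bar \<alpha>"
  using assms cf_map_range[OF assms(1,2)] by (cases n; simp add: cf_orbit_Suc)+

text \<open>
  The functional equation. No convergence at \<open>cf_map \<alpha> y\<close> has to be assumed, since the tail of the series
  at \<open>y\<close> is \<open>- y\<close> times the series there.
\<close>

lemma summable_wilton_term_shift:
  assumes "y \<noteq> 0" "summable (wilton_term \<alpha> y)"
  shows "summable (wilton_term \<alpha> (cf_map \<alpha> y))"
    "wilton_series \<alpha> y = - ln y - y * wilton_series \<alpha> (cf_map \<alpha> y)"
proof -
  have eq: "wilton_term \<alpha> y (Suc j) = - y * wilton_term \<alpha> (cf_map \<alpha> y) j" for j
    by (simp add: wilton_term_def cf_orbit_prod_Suc' cf_orbit_Suc')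
  have "summable (\<lambda>j. - y * wilton_term \<alpha> (cf_map \<alpha> y) j)"
    using assms(2) by (subst (asm) summable_Suc_iff[symmetric]) (simp add: eq)
  then show s: "summable (wilton_term \<alpha> (cf_map \<alpha> y))"
    using assms(1) by (subst (asm) summable_cmult_iff) auto
  have "wilton_series \<alpha> y = wilton_term \<alpha> y 0 + (\<Sum>j. wilton_term \<alpha> y (Suc j))"
    unfolding wilton_series_def using suminf_split_head[OF assms(2)] by simp
  also have "(\<Sum>j. wilton_term \<alpha> y (Suc j)) = - y * wilton_series \<alpha> (cf_map \<alpha> y)"
    unfolding eq wilton_series_def by (rule suminf_mult[OF s])
  finally show "wilton_series \<alpha> y = - ln y - y * wilton_series \<alpha> (cf_map \<alpha> y)"
    by (simp add: wilton_term_def ln_div)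
qed

text \<open>
  Two consecutive points have a product bounded away from \<open>1\<close>. For \<open>\<alpha> < 1\<close> the bound on one point suffices; for
  \<open>\<alpha> = 1\<close> a point above \<open>1 / 2\<close> is followed by \<open>1 / x - 1\<close>, and the product is \<open>1 - x\<close>.
\<close>

lemma mult_cf_map_le:
  assumes "0 < \<alpha>" "\<alpha> \<le> 1" "0 \<le> x" "x \<le> alpha_bar \<alpha>"
  shows "x * cf_map \<alpha> x \<le> (if \<alpha> = 1 then 1/2 else alpha_bar \<alpha>)"
proof (cases "\<alpha> = 1")
  case False
  have "x * cf_map \<alpha> x \<le> 1 * alpha_bar \<alpha>"
    using assms alpha_bar_bounds[OF assms(1,2)] cf_map_range[OF assms(1,2)] by (intro mult_mono) (auto intro: order.trans)
  with False show ?thesis by simp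
next
  case True
  show ?thesis
  proof (cases "x \<le> 1/2")
    case le: True
    have "x * cf_map \<alpha> x \<le> (1/2) * 1"
      using le assms alpha_bar_bounds[OF assms(1,2)] cf_map_range[OF assms(1,2)] by (intro mult_mono) (auto intro: order.trans)
    with True show ?thesis by simp
  next
    case gt: False
    have x1: "x \<le> 1" using assms alpha_bar_bounds[OF assms(1,2)] by linarith
    have "\<lfloor>1 / x\<rfloor> = 1"
      using gt x1 assms(3) by (intro floor_unique) (auto simp: field_simps)
    then have "cf_map \<alpha> x = 1 / x - 1"
      using gt x1 True by (simp add: cf_map_def)
    then have "x * cf_map \<alpha> x = 1 - x" using gt by (simp add: field_simps)
    with gt True show ?thesis by simp
  qed
qed

lemma cf_orbit_prod_decay:
  assumes "0 < \<alpha>" "\<alpha> \<le> 1"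
  obtains C \<mu> where "0 < \<mu>" "\<mu> < 1" "C > 0"
    "\<And>y n. 0 \<le> y \<Longrightarrow> y \<le> alpha_bar \<alpha> \<Longrightarrow> cf_orbit_prod \<alpha> n y \<le> C * \<mu> ^ n"
proof -
  define l where "l = (if \<alpha> = 1 then 1/2 else alpha_bar \<alpha>)"
  have l: "0 < l" "l < 1" using assms by (auto simp: l_def alpha_bar_def max_def)
  define \<mu> where "\<mu> = sqrt l"
  have \<mu>: "0 < \<mu>" "\<mu> < 1" "\<mu> * \<mu> = l" using l by (auto simp: \<mu>_def)
  have "cf_orbit_prod \<alpha> n y \<le> (1/\<mu>) * \<mu> ^ n" if y: "0 \<le> y" "y \<le> alpha_bar \<alpha>" for y n
  proof (induction n rule: nat_less_induct)
    case (1 n)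
    consider "n = 0" | "n = 1" | m where "n = Suc (Suc m)"
      by (metis One_nat_def not0_implies_Suc)
    then show ?case
    proof cases
      case 1 then show ?thesis using \<mu> by simp
    next
      case 2 then show ?thesis using \<mu> y alpha_bar_bounds[OF assms] by (simp add: cf_orbit_prod_def)
    next
      case 3
      have "cf_orbit_prod \<alpha> n y = cf_orbit_prod \<alpha> m y * (cf_orbit \<alpha> m y * cf_map \<alpha> (cf_orbit \<alpha> m y))"
        by (simp add: 3 cf_orbit_prod_Suc cf_orbit_Suc)
      also have "\<dots> \<le> ((1/\<mu>) * \<mu> ^ m) * l"
      proof (intro mult_mono)
        show "cf_orbit_prod \<alpha> m y \<le> (1/\<mu>) * \<mu> ^ m" using 1 3 by auto
        show "cf_orbit \<alpha> m y * cf_map \<alpha> (cf_orbit \<alpha> m y) \<le> l"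
          unfolding l_def using mult_cf_map_le[OF assms] cf_orbit_range[OF assms y] by blast
        show "0 \<le> cf_orbit \<alpha> m y * cf_map \<alpha> (cf_orbit \<alpha> m y)"
          using cf_orbit_range[OF assms y] cf_map_range[OF assms] by simp
      qed (use \<mu> in auto)
      also have "\<dots> = (1/\<mu>) * \<mu> ^ n" by (simp add: 3 \<mu>(3)[symmetric])
      finally show ?thesis .
    qed
  qed
  then show thesis using that[of \<mu> "1/\<mu>"] \<mu> by auto
qed

text \<open>
  The products are integer combinations of \<open>1\<close> and \<open>y\<close>, by the recursion
  \<open>P (n + 2) = \<bar>P n - a P (n + 1)\<bar>\<close>, where \<open>P n\<close> is the product of the first \<open>n\<close> points, \<open>x\<close> the next
  point and \<open>a = floor (1 / x + 1 - \<alpha>)\<close>. As \<open>1 + a \<le> 3 / x\<close>, each step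
  enlarges the coefficients by at most that factor. This is much weaker than the usual bound for the
  denominators of the convergents, but needs no monotonicity of them.
\<close>

lemma cf_orbit_prod_int_combination:
  assumes \<alpha>: "0 < \<alpha>" "\<alpha> \<le> 1" and y: "0 \<le> y" "y \<le> alpha_bar \<alpha>"
    and pos: "\<And>i. cf_orbit \<alpha> i y > 0"
  shows "\<exists>q p q' p' :: int. cf_orbit_prod \<alpha> n y = of_int q * y - of_int p \<and>
     cf_orbit_prod \<alpha> (Suc n) y = of_int q' * y - of_int p' \<and>
     \<bar>of_int q\<bar> \<le> 3 ^ n / cf_orbit_prod \<alpha> n y \<and> \<bar>of_int q'\<bar> \<le> 3 ^ n / cf_orbit_prod \<alpha> n y"
proof (induction n)
  case 0
  show ?case
    by (rule exI[of _ 0], rule exI[of _ "-1"], rule exI[of _ 1], rule exI[of _ 0]) (simp add: cf_orbit_prod_Suc)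
next
  case (Suc n)
  let ?b = "\<lambda>n. cf_orbit_prod \<alpha> n y"
  have bpos: "?b n > 0" for n using pos by (simp add: cf_orbit_prod_def prod_pos)
  obtain q p q' p' :: int where 1: "?b n = of_int q * y - of_int p" "?b (Suc n) = of_int q' * y - of_int p'"
    "\<bar>of_int q\<bar> \<le> 3 ^ n / ?b n" "\<bar>of_int q'\<bar> \<le> 3 ^ n / ?b n" using Suc by blast
  define x where "x = cf_orbit \<alpha> n y"
  have x: "0 < x" "x \<le> 1" using pos cf_orbit_range[OF \<alpha> y, of n] alpha_bar_bounds[OF \<alpha>] by (auto simp: x_def intro: order.trans)
  define a where "a = \<lfloor>1 / x + 1 - \<alpha>\<rfloor>"
  have x1: "1 / x \<ge> 1" using x by simp
  have a: "0 \<le> a" "of_int a \<le> 1 / x + 1" using x1 \<alpha> unfolding a_def by linarith+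
  have bS: "?b (Suc n) = ?b n * x" by (simp add: cf_orbit_prod_Suc x_def)
  have "?b (Suc (Suc n)) = ?b (Suc n) * \<bar>1 / x - of_int a\<bar>"
    using x by (simp add: cf_orbit_prod_Suc cf_orbit_Suc x_def[symmetric] cf_map_def a_def)
  also have "\<dots> = \<bar>?b (Suc n) * (1 / x - of_int a)\<bar>" using bpos[of "Suc n"] by (simp add: abs_mult)
  also have "?b (Suc n) * (1 / x - of_int a) = ?b n - of_int a * ?b (Suc n)"
    using x by (simp add: bS field_simps)
  also have "\<dots> = of_int (q - a * q') * y - of_int (p - a * p')" by (simp add: 1 algebra_simps)
  finally have e: "?b (Suc (Suc n)) = \<bar>of_int (q - a * q') * y - of_int (p - a * p')\<bar>" .
  have "3 ^ n / ?b n * (1 + of_int a) \<le> 3 ^ n / ?b n * (3 / x)"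
    using a x1 bpos[of n] by (intro mult_left_mono) auto
  also have "\<dots> = 3 ^ Suc n / ?b (Suc n)" by (simp add: bS)
  finally have m: "3 ^ n / ?b n * (1 + of_int a) \<le> 3 ^ Suc n / ?b (Suc n)" .
  have m1: "3 ^ n / ?b n \<le> 3 ^ n / ?b n * (1 + of_int a)"
    using a bpos[of n] mult_left_mono[of 1 "1 + real_of_int a" "3 ^ n / ?b n"] by simp
  have q'b: "\<bar>of_int q'\<bar> \<le> 3 ^ Suc n / ?b (Suc n)" using 1(4) m m1 by linarith
  have "\<bar>of_int (q - a * q') :: real\<bar> \<le> \<bar>of_int q\<bar> + of_int a * \<bar>of_int q'\<bar>"
    using a(1) abs_triangle_ineq4[of "of_int q :: real" "of_int a * of_int q'"] by (simp add: abs_mult)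
  also have "\<dots> \<le> 3 ^ n / ?b n + of_int a * (3 ^ n / ?b n)" using 1 a by (intro add_mono mult_left_mono) auto
  finally have qb: "\<bar>of_int (q - a * q') :: real\<bar> \<le> 3 ^ Suc n / ?b (Suc n)" using m
    unfolding distrib_left by (simp add: mult.commute)
  obtain Q P :: int where "?b (Suc (Suc n)) = of_int Q * y - of_int P" "\<bar>of_int Q\<bar> \<le> 3 ^ Suc n / ?b (Suc n)"
  proof (cases "of_int (q - a * q') * y - of_int (p - a * p') \<ge> (0::real)")
    case True
    then show ?thesis using e qb that[of "q - a * q'" "p - a * p'"] by linarith
  next
    case False
    then have "?b (Suc (Suc n)) = of_int (- (q - a * q')) * y - of_int (- (p - a * p'))"
      using e by (simp add: algebra_simps)
    then show ?thesis using qb that[of "- (q - a * q')" "- (p - a * p')"] by simp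
  qed
  then show ?case using q'b 1(2) by blast
qed

text \<open>
  If \<open>y\<close> is badly approximable in the sense of \<open>negligible_well_approximable\<close>, the \<open>n\<close>-th term is
  \<open>O (sqrt (P n))\<close>, where \<open>P n\<close> is the product of the first \<open>n\<close> points: by
  \<open>P (n + 1) = \<bar>q y - p\<bar> > c / q\<^sup>2\<close> and \<open>\<bar>q\<bar> \<le> 3\<^sup>n / P n \<le> D / (P n)\<^sup>k\<^sup>+\<^sup>1\<close>, the next point
  \<open>P (n + 1) / P n\<close> is at least a multiple of a power of \<open>P n\<close>. An orbit that
  reaches \<open>0\<close> gives a finite sum, as \<open>ln (1 / 0) = 0\<close>.
\<close>

lemma summable_wilton_term:
  assumes \<alpha>: "0 < \<alpha>" "\<alpha> \<le> 1" and y: "0 \<le> y" "y \<le> alpha_bar \<alpha>" "y < 1"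
    and c: "c > 0" "\<And>q p::int. q \<noteq> 0 \<Longrightarrow> \<bar>p\<bar> \<le> 2 * \<bar>q\<bar> \<Longrightarrow> \<bar>of_int q * y - of_int p\<bar> > c / (of_int q)\<^sup>2"
  shows "summable (wilton_term \<alpha> y)"
proof (cases "\<exists>i. cf_orbit \<alpha> i y = 0")
  case True
  then obtain i where i: "cf_orbit \<alpha> i y = 0" by blast
  have "wilton_term \<alpha> y j = 0" if "j \<notin> {..<i}" for j
  proof (cases "j = i")
    case True then show ?thesis using i by (simp add: wilton_term_def)
  next
    case False
    then have "cf_orbit_prod \<alpha> j y = 0" unfolding cf_orbit_prod_def using i that by (intro prod_zero) auto
    then show ?thesis by (simp add: wilton_term_def)
  qed
  then show ?thesis by (intro summable_finite[of "{..<i}"]) auto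
next
  case False
  then have pos: "cf_orbit \<alpha> i y > 0" for i using cf_orbit_range[OF \<alpha> y(1,2), of i] by (metis order_le_less)
  let ?b = "\<lambda>n. cf_orbit_prod \<alpha> n y"
  have bpos: "?b n > 0" for n using pos by (simp add: cf_orbit_prod_def prod_pos)
  obtain C \<mu> where \<mu>: "0 < \<mu>" "\<mu> < 1" "C > 0" and dec: "\<And>n. ?b n \<le> C * \<mu> ^ n"
    using cf_orbit_prod_decay[OF \<alpha>] y by metis
  have bSy: "?b (Suc n) \<le> y" for n
  proof (induction n)
    case (Suc n)
    have "cf_orbit \<alpha> (Suc n) y \<le> 1" using cf_orbit_range[OF \<alpha> y(1,2), of "Suc n"] alpha_bar_bounds[OF \<alpha>] by linarith
    then have "?b (Suc n) * cf_orbit \<alpha> (Suc n) y \<le> ?b (Suc n)" using bpos[of "Suc n"] by (simp add: mult_left_le)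
    then show ?case using Suc by (simp add: cf_orbit_prod_Suc[of _ "Suc n"])
  qed (simp add: cf_orbit_prod_Suc)
  have b1: "?b n \<le> 1" for n using bSy[of "n - 1"] y by (cases n) auto
  obtain k where k: "\<mu> ^ k < 1/3" using real_arch_pow_inv[of "1/3" \<mu>] \<mu> by auto
  define D where "D = C ^ k"
  have "D > 0" using \<mu> by (simp add: D_def)
  have three: "3 ^ n \<le> D / ?b n ^ k" for n
  proof -
    have "?b n ^ k \<le> (C * \<mu> ^ n) ^ k" using dec bpos[of n] by (intro power_mono) auto
    also have "\<dots> = D * (\<mu> ^ k) ^ n" by (simp add: D_def power_mult_distrib flip: power_mult) (simp add: mult.commute)
    also have "\<dots> \<le> D * (1/3) ^ n" using k \<mu> \<open>D > 0\<close> by (intro mult_left_mono power_mono) auto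
    finally show ?thesis using bpos[of n] by (simp add: field_simps power_divide)
  qed
  \<comment> \<open>Squaring \<open>?b n ^ (k + 1)\<close> and dividing by \<open>?b n\<close> leaves this exponent.\<close>
  define m where "m = 2 * k + 1"
  define c' where "c' = c / D\<^sup>2"
  have "c' > 0" using c \<open>D > 0\<close> by (simp add: c'_def)
  have low: "cf_orbit \<alpha> n y \<ge> c' * ?b n ^ m" for n
  proof -
    obtain q p :: int where q: "?b (Suc n) = of_int q * y - of_int p" "\<bar>of_int q\<bar> \<le> 3 ^ n / ?b n"
      using cf_orbit_prod_int_combination[OF \<alpha> y(1,2) pos, of n] by blast
    \<comment> \<open>Otherwise the product would be an integer strictly between \<open>0\<close> and \<open>1\<close>.\<close>
    have q0: "q \<noteq> 0"
    proof
      assume "q = 0"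
      then have "?b (Suc n) = of_int (- p)" using q by simp
      then have "(0::real) < of_int (- p)" "of_int (- p) < (1::real)" using bpos[of "Suc n"] bSy[of n] y by linarith+
      then have "0 < - p" "- p < 1" by (simp_all only: of_int_0_less_iff of_int_less_1_iff)
      then show False by linarith
    qed
    have "\<bar>real_of_int p\<bar> \<le> 2 * \<bar>of_int q\<bar>"
    proof -
      have "\<bar>real_of_int p\<bar> \<le> \<bar>of_int q * y\<bar> + ?b (Suc n)" using q(1) bpos[of "Suc n"] by linarith
      also have "\<bar>of_int q * y\<bar> \<le> \<bar>of_int q\<bar> * 1" unfolding abs_mult using y by (intro mult_left_mono) auto
      finally have "\<bar>real_of_int p\<bar> \<le> \<bar>of_int q\<bar> + 1" using b1[of "Suc n"] by linarith
      moreover have "1 \<le> \<bar>real_of_int q\<bar>" using q0 by linarith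
      ultimately show ?thesis by linarith
    qed
    then have "\<bar>p\<bar> \<le> 2 * \<bar>q\<bar>" by linarith
    from c(2)[OF q0 this] have "c / (of_int q)\<^sup>2 < ?b (Suc n)" using q(1) bpos[of "Suc n"] by simp
    moreover have "(of_int q)\<^sup>2 \<le> (D / ?b n ^ (k+1))\<^sup>2"
    proof -
      have "3 ^ n / ?b n \<le> D / ?b n ^ k / ?b n" using three[of n] bpos[of n] by (intro divide_right_mono) auto
      then have "\<bar>of_int q\<bar> \<le> D / ?b n ^ (k+1)" using q(2) by (simp add: field_simps)
      then show ?thesis by (metis abs_ge_zero power2_abs power_mono)
    qed
    then have "c / (D / ?b n ^ (k+1))\<^sup>2 \<le> c / (of_int q)\<^sup>2"
      using c(1) q0 by (intro divide_left_mono) (auto simp: \<open>D > 0\<close> less_imp_neq[OF bpos, symmetric] intro!: mult_pos_pos)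
    ultimately have "c / (D / ?b n ^ (k+1))\<^sup>2 \<le> ?b n * cf_orbit \<alpha> n y" by (simp add: cf_orbit_prod_Suc)
    moreover have "c / (D / ?b n ^ (k+1))\<^sup>2 = ?b n * (c' * ?b n ^ m)"
      by (simp add: c'_def m_def power_divide flip: power_mult) (simp add: mult_2 power_add power2_eq_square)
    ultimately show ?thesis using bpos[of n] by simp
  qed
  have bound: "norm (wilton_term \<alpha> y n) \<le> \<bar>ln c'\<bar> * (C * \<mu> ^ n) + real m * (2 * (sqrt C * sqrt \<mu> ^ n))" for n
  proof -
    have o: "0 < cf_orbit \<alpha> n y" "cf_orbit \<alpha> n y \<le> 1" using pos cf_orbit_range[OF \<alpha> y(1,2), of n] alpha_bar_bounds[OF \<alpha>] by auto
    have "norm (wilton_term \<alpha> y n) = ?b n * (- ln (cf_orbit \<alpha> n y))"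
      using bpos[of n] o by (simp add: wilton_term_def abs_mult power_abs ln_div)
    also have "\<dots> \<le> ?b n * (- ln (c' * ?b n ^ m))"
      using low[of n] \<open>c' > 0\<close> bpos[of n] o by (intro mult_left_mono) auto
    also have "\<dots> = ?b n * (- ln c') + real m * (?b n * (- ln (?b n)))"
      using \<open>c' > 0\<close> bpos[of n] by (simp add: ln_mult ln_realpow algebra_simps)
    finally have 1: "norm (wilton_term \<alpha> y n) \<le> ?b n * (- ln c') + real m * (?b n * (- ln (?b n)))" .
    \<comment> \<open>\<open>t ln (1 / t) \<le> 2 sqrt t\<close>, which keeps geometric decay.\<close>
    define s where "s = sqrt (?b n)"
    have s: "s > 0" "?b n = s * s" using bpos[of n] by (auto simp: s_def)
    have "- ln s \<le> 1 / s" using ln_bound[of "1/s"] s(1) by (simp add: ln_div)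
    then have "s * s * (2 * (- ln s)) \<le> s * s * (2 * (1 / s))" using s(1) by (intro mult_left_mono) auto
    moreover have "s * s * (2 * (1 / s)) = 2 * s" using s(1) by simp
    moreover have "?b n * (- ln (?b n)) = s * s * (2 * (- ln s))" unfolding s(2) using s(1) by (simp add: ln_mult)
    moreover have "s \<le> sqrt C * sqrt \<mu> ^ n"
      unfolding s_def using real_sqrt_le_mono[OF dec[of n]] by (simp add: real_sqrt_mult real_sqrt_power)
    ultimately have "?b n * (- ln (?b n)) \<le> 2 * (sqrt C * sqrt \<mu> ^ n)" by linarith
    then have 2: "real m * (?b n * (- ln (?b n))) \<le> real m * (2 * (sqrt C * sqrt \<mu> ^ n))"
      by (rule mult_left_mono) simp
    have "?b n * (- ln c') \<le> ?b n * \<bar>ln c'\<bar>"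
      using bpos[of n] by (intro mult_left_mono) auto
    also have "\<dots> \<le> (C * \<mu> ^ n) * \<bar>ln c'\<bar>"
      using dec[of n] by (intro mult_right_mono) auto
    finally have "?b n * (- ln c') \<le> (C * \<mu> ^ n) * \<bar>ln c'\<bar>" .
    with 1 2 show ?thesis by (simp only: mult.commute[of "C * \<mu> ^ n"])
  qed
  show ?thesis
  proof (rule summable_comparison_test'[where N=0])
    show "summable (\<lambda>n. \<bar>ln c'\<bar> * (C * \<mu> ^ n) + real m * (2 * (sqrt C * sqrt \<mu> ^ n)))"
      using \<mu> by (intro summable_add summable_mult summable_geometric) auto
  qed (use bound in auto)
qed

lemma negligible_nonsummable:
  assumes "0 < \<alpha>" "\<alpha> \<le> 1"
  shows "negligible {y. 0 < y \<and> y < alpha_bar \<alpha> \<and> \<not> summable (wilton_term \<alpha> y)}"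
proof (rule negligible_subset[OF negligible_well_approximable], safe)
  fix y c :: real assume y: "0 < y" "y < alpha_bar \<alpha>" "\<not> summable (wilton_term \<alpha> y)" and "0 < c"
  show "\<exists>q p::int. q \<noteq> 0 \<and> \<bar>p\<bar> \<le> 2 * \<bar>q\<bar> \<and> \<bar>of_int q * y - of_int p\<bar> \<le> c / (of_int q)\<^sup>2"
  proof (rule ccontr)
    assume "\<not> ?thesis"
    then have "summable (wilton_term \<alpha> y)"
      using y alpha_bar_bounds[OF assms] by (intro summable_wilton_term[OF assms _ _ _ \<open>0 < c\<close>]) (auto simp: not_le, meson not_le)
    with y show False by simp
  qed
qed

section \<open>Tameness along rational orbits\<close>

lemma wilton_left:
  assumes "0 \<le> x" "x < alpha_bar \<alpha>" "alpha_bar \<alpha> \<le> 1"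
  shows "wilton \<alpha> x = wilton_series \<alpha> x"
proof -
  have "\<lfloor>x + 1 - alpha_bar \<alpha>\<rfloor> = 0" using assms by (intro floor_unique) auto
  then show ?thesis using assms by (simp add: wilton_eq_wilton_series)
qed

lemma wilton_right:
  assumes "alpha_bar \<alpha> \<le> x" "x < 1 + alpha_bar \<alpha>"
  shows "wilton \<alpha> x = wilton_series \<alpha> \<bar>x - 1\<bar>"
proof -
  have "\<lfloor>x + 1 - alpha_bar \<alpha>\<rfloor> = 1" using assms by (intro floor_unique) auto
  then show ?thesis using assms by (simp add: wilton_eq_wilton_series)
qed

lemma image_inverse_shift:
  fixes u :: real
  assumes "0 < a" "a \<le> b"
  shows "(\<lambda>x. 1 / x - u) ` {a..b} = {1 / b - u..1 / a - u}"
    "(\<lambda>x. u - 1 / x) ` {a..b} = {u - 1 / a..u - 1 / b}"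
proof -
  have *: "(\<lambda>x. 1 / x) ` {a..b} = {1 / b..1 / a}"
  proof (intro subset_antisym subsetI)
    fix y assume "y \<in> {1 / b..1 / a}"
    moreover have "0 < 1 / b" using assms by simp
    ultimately have "y > 0" by (meson atLeastAtMost_iff less_le_trans)
    then have "1 / y \<in> {a..b}" using assms \<open>y \<in> _\<close> by (auto simp: field_simps)
    then show "y \<in> (\<lambda>x. 1 / x) ` {a..b}" by (intro image_eqI[of _ _ "1 / y"]) auto
  qed (use assms in \<open>auto simp: frac_le\<close>)
  have "(\<lambda>x. 1 / x - u) ` {a..b} = (\<lambda>z. z - u) ` (\<lambda>x. 1 / x) ` {a..b}" by (simp add: image_image)
  then show "(\<lambda>x. 1 / x - u) ` {a..b} = {1 / b - u..1 / a - u}" unfolding * by simp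
  have "(\<lambda>x. u - 1 / x) ` {a..b} = (\<lambda>z. u - z) ` (\<lambda>x. 1 / x) ` {a..b}" by (simp add: image_image)
  then show "(\<lambda>x. u - 1 / x) ` {a..b} = {u - 1 / a..u - 1 / b}" unfolding * by simp
qed

lemma inverse_shift_has_field_derivative:
  fixes u :: real
  assumes "x \<noteq> 0"
  shows "((\<lambda>x. 1 / x - u) has_field_derivative - (1 / x\<^sup>2)) (at x within S)"
    "((\<lambda>x. u - 1 / x) has_field_derivative 1 / x\<^sup>2) (at x within S)"
  by (rule derivative_eq_intros refl assms | simp add: power2_eq_square)+

lemma cf_map_eq:
  assumes "x \<noteq> 0" "of_int n \<le> 1 / x + 1 - \<alpha>" "1 / x + 1 - \<alpha> < of_int n + 1"
  shows "cf_map \<alpha> x = \<bar>1 / x - of_int n\<bar>"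
proof -
  have "\<lfloor>1 / x + 1 - \<alpha>\<rfloor> = n" using assms by (intro floor_unique) auto
  with assms show ?thesis by (simp add: cf_map_def)
qed

text \<open>
  Only points \<open>x < r\<close> are used: \<open>floor (1 / x + 1 - \<alpha>)\<close> is left-continuous in \<open>x\<close>, so its value \<open>n\<close> at \<open>r\<close> persists
  to the left of \<open>r\<close> even if \<open>A\<close> jumps at \<open>r\<close>, and \<open>A x\<close> is \<open>1 / x - n\<close> or \<open>n - 1 / x\<close> there according to the sign of
  \<open>1 / r - n\<close>. The image lies on one side of \<open>A r\<close>, which is enough by \<open>BMO_tame\<close>.
\<close>

lemma tame_cf_map:
  assumes \<alpha>: "0 < \<alpha>" "\<alpha> \<le> 1" and f: "wilton \<alpha> \<in> BMO" and tame: "tame (wilton \<alpha>) r"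
    and r: "0 < r" "r \<le> alpha_bar \<alpha>"
  shows "tame (wilton \<alpha>) (cf_map \<alpha> r)"
proof -
  let ?f = "wilton \<alpha>"
  note ab = alpha_bar_bounds[OF \<alpha>]
  obtain C d where d: "d > 0" "\<And>a b e. 0 < e \<Longrightarrow> e < d \<Longrightarrow> r - e \<le> a \<Longrightarrow> b \<le> r + e \<Longrightarrow>
     integral {a..b} (\<lambda>x. \<bar>?f x\<bar>) \<le> C * e"
    using tame_subset[OF f tame] by metis
  define n where "n = \<lfloor>1 / r + 1 - \<alpha>\<rfloor>"
  define y0 where "y0 = 1 / r - of_int n"
  have y0: "\<alpha> - 1 \<le> y0" "y0 < \<alpha>" unfolding y0_def n_def by linarith+
  have Ar: "cf_map \<alpha> r = \<bar>y0\<bar>" using r by (simp add: cf_map_def y0_def n_def)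
  define L where "L = \<bar>ln (r / 2)\<bar>"
  define E where "E = Min {1 / r, d / r\<^sup>2, if y0 \<ge> 0 then \<alpha> - y0 else - y0}"
  have E: "E > 0" "E \<le> 1 / r" "E \<le> d / r\<^sup>2" "E \<le> (if y0 \<ge> 0 then \<alpha> - y0 else - y0)"
    using r d(1) y0 by (auto simp: E_def)
  define B where "B = (8 / r ^ 3) * (L * r\<^sup>2 + C * r\<^sup>2)"
  define g where "g x = (if y0 \<ge> 0 then 1 / x - of_int n else of_int n - 1 / x)" for x :: real
  \<comment> \<open>The point \<open>r\<close> is excluded because \<open>r = alpha_bar \<alpha>\<close> is allowed, where \<open>wilton\<close> and \<open>wilton_series\<close> may differ.\<close>
  define N where "N = insert r {y. 0 < y \<and> y < alpha_bar \<alpha> \<and> \<not> summable (wilton_term \<alpha> y)}"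
  have N: "negligible N" unfolding N_def using negligible_nonsummable[OF \<alpha>] by simp
  \<comment> \<open>In both cases the interval is the image under \<open>g\<close> of an interval \<open>{x1..r}\<close> of length at most \<open>r\<^sup>2 * e\<close>.\<close>
  have key: "integral (if y0 \<ge> 0 then {y0..y0 + e} else {- y0 - e..- y0}) (\<lambda>x. \<bar>?f x\<bar>) \<le> B * e"
    if e: "0 < e" "e < E" for e
  proof -
    define x1 where "x1 = 1 / (1 / r + e)"
    have inv: "1 / x1 = 1 / r + e" by (simp add: x1_def)
    have x1: "0 < x1" "x1 \<le> r" using r e divide_left_mono[of "1 / r" "1 / r + e" 1] add_pos_pos[of "1 / r" e] by (auto simp: x1_def)
    have x1h: "r / 2 \<le> x1"
      using order_less_le_trans[OF e(2) E(2)] r e add_pos_pos[of "1 / r" e] divide_left_mono[of "1 / r + e" "2 / r" 1]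
      by (simp add: x1_def)
    have x1l: "r - r\<^sup>2 * e \<le> x1"
    proof -
      have "(r - r\<^sup>2 * e) * (1 / r + e) = 1 - r\<^sup>2 * e * e" using r by (simp add: field_simps power2_eq_square)
      also have "\<dots> \<le> 1" using e by simp
      finally show ?thesis unfolding x1_def using r e by (subst pos_le_divide_eq) (auto intro: add_pos_pos)
    qed
    let ?S = "{x1..r}"
    have img: "g ` ?S = (if y0 \<ge> 0 then {y0..y0 + e} else {- y0 - e..- y0})"
      using image_inverse_shift[OF x1, of "of_int n"] inv by (simp add: g_def y0_def)
    have der: "(g has_field_derivative (if y0 \<ge> 0 then - (1 / x\<^sup>2) else 1 / x\<^sup>2)) (at x within ?S)" if "x \<in> ?S" for x
      using that x1 inverse_shift_has_field_derivative[of x] unfolding g_def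
      by (cases "y0 \<ge> 0") auto
    have inj: "inj_on g ?S" unfolding g_def inj_on_def by auto
    have ai: "(\<lambda>x. \<bar>?f x\<bar>) absolutely_integrable_on g ` ?S"
      unfolding img using set_integrable_abs[OF BMO_absolutely_integrable[OF f]] by auto
    note sub = absolutely_integrable_substitution[OF ai der inj]
    have fi: "(\<lambda>x. \<bar>?f x\<bar>) integrable_on ?S" by (rule BMO_integrable(2)[OF f])
    have "integral (g ` ?S) (\<lambda>x. \<bar>?f x\<bar>)
        = integral ?S (\<lambda>x. \<bar>if 0 \<le> y0 then - (1 / x\<^sup>2) else 1 / x\<^sup>2\<bar> * \<bar>?f (g x)\<bar>)"
      by (rule sub(2)[symmetric])
    also have "\<dots> \<le> integral ?S (\<lambda>x. (8 / r ^ 3) * (L + \<bar>?f x\<bar>))"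
    proof (rule integral_le_off_negligible[OF N sub(1)])
      show "(\<lambda>x. (8 / r ^ 3) * (L + \<bar>?f x\<bar>)) integrable_on ?S"
        using fi by (intro integrable_on_mult_right integrable_add) auto
      fix x assume x: "x \<in> ?S - N"
      then have x': "x1 \<le> x" "x < r" "0 < x" "r / 2 \<le> x" "x < alpha_bar \<alpha>" "x < 1" using x1 x1h r ab by (auto simp: N_def)
      have "1 / r < 1 / x" "1 / x \<le> 1 / x1" using x' x1 by (auto intro!: divide_strict_left_mono divide_left_mono)
      then have y: "y0 < 1 / x - of_int n" "1 / x - of_int n \<le> y0 + e" using inv by (auto simp: y0_def)
      have "cf_map \<alpha> x = \<bar>1 / x - of_int n\<bar>"
        using x' y y0 e E(4) \<alpha> by (intro cf_map_eq) (auto split: if_splits)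
      then have Ax: "cf_map \<alpha> x = g x" "0 \<le> g x" "g x < alpha_bar \<alpha>"
        using y y0 e E(4) ab unfolding g_def by (auto split: if_splits)
      have "summable (wilton_term \<alpha> x)" using x x' by (auto simp: N_def)
      then have "?f x = - ln x - x * ?f (g x)"
        using summable_wilton_term_shift(2)[of x \<alpha>] x' Ax wilton_left[of "g x" \<alpha>] wilton_left[of x \<alpha>] ab by simp
      then have "x * ?f (g x) = - ln x - ?f x" by simp
      then have "x * \<bar>?f (g x)\<bar> = \<bar>- ln x - ?f x\<bar>" using x'(3) by (simp add: abs_mult flip: \<open>x * ?f (g x) = - ln x - ?f x\<close>)
      also have "\<dots> \<le> \<bar>ln x\<bar> + \<bar>?f x\<bar>" by linarith
      also have "\<bar>ln x\<bar> \<le> L" using x' r by (simp add: L_def)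
      finally have "x * \<bar>?f (g x)\<bar> \<le> L + \<bar>?f x\<bar>" by simp
      moreover have "1 / x ^ 3 \<le> 8 / r ^ 3"
      proof -
        have "1 / x ^ 3 \<le> 1 / (r / 2) ^ 3" using x' r by (intro divide_left_mono power_mono) auto
        then show ?thesis by (simp add: power_divide)
      qed
      ultimately have "1 / x ^ 3 * (x * \<bar>?f (g x)\<bar>) \<le> 8 / r ^ 3 * (L + \<bar>?f x\<bar>)"
        using x' r by (intro mult_mono) auto
      moreover have "1 / x ^ 3 * (x * \<bar>?f (g x)\<bar>) = 1 / x\<^sup>2 * \<bar>?f (g x)\<bar>"
        using x' by (simp add: power2_eq_square power3_eq_cube)
      moreover have "\<bar>if 0 \<le> y0 then - (1 / x\<^sup>2) else 1 / x\<^sup>2\<bar> = 1 / x\<^sup>2" by simp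
      ultimately show "\<bar>if 0 \<le> y0 then - (1 / x\<^sup>2) else 1 / x\<^sup>2\<bar> * \<bar>?f (g x)\<bar> \<le> 8 / r ^ 3 * (L + \<bar>?f x\<bar>)"
        by simp
    qed
    also have "\<dots> = (8 / r ^ 3) * (L * (r - x1) + integral ?S (\<lambda>x. \<bar>?f x\<bar>))"
      unfolding Henstock_Kurzweil_Integration.integral_mult_right
        Henstock_Kurzweil_Integration.integral_add[OF integrable_const_ivl fi] using x1 by (simp add: mult.commute)
    also have "\<dots> \<le> (8 / r ^ 3) * (L * (r\<^sup>2 * e) + C * (r\<^sup>2 * e))"
    proof -
      have "r\<^sup>2 * e < d" using order_less_le_trans[OF e(2) E(3)] r by (simp add: field_simps)
      then have "integral ?S (\<lambda>x. \<bar>?f x\<bar>) \<le> C * (r\<^sup>2 * e)"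
        using e r x1l by (intro d(2)) auto
      moreover have "L * (r - x1) \<le> L * (r\<^sup>2 * e)" using x1l by (intro mult_left_mono) (auto simp: L_def)
      ultimately show ?thesis using r by (intro mult_left_mono) auto
    qed
    also have "\<dots> = B * e" by (simp add: B_def algebra_simps)
    finally show ?thesis unfolding img .
  qed
  show ?thesis
  proof (rule BMO_tame[OF f E(1)])
    fix e assume e: "0 < e" "e < E"
    have le: "\<bar>integral {a..b} ?f\<bar> \<le> integral {a..b} (\<lambda>x. \<bar>?f x\<bar>)" for a b
      using integral_norm_bound_integral[OF BMO_integrable(1,2)[OF f, of a b]] by simp
    show "\<bar>integral {cf_map \<alpha> r - e..cf_map \<alpha> r} ?f\<bar> \<le> B * e \<or> \<bar>integral {cf_map \<alpha> r..cf_map \<alpha> r + e} ?f\<bar> \<le> B * e"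
      using key[OF e] le[of "cf_map \<alpha> r - e" "cf_map \<alpha> r"] le[of "cf_map \<alpha> r" "cf_map \<alpha> r + e"]
      by (auto simp: Ar split: if_splits)
  qed
qed

text \<open>
  Let \<open>\<Phi> n\<close> be the integral of \<open>\<bar>W\<bar>\<close> over \<open>{0..1 / n}\<close>. On the interval from \<open>1 / (n + \<alpha>)\<close> to \<open>1 / n\<close>, where
  \<open>A x = 1 / x - n\<close>, the term \<open>- ln x\<close> contributes about \<open>ln n / n\<^sup>2\<close>, while \<open>x W (A x)\<close> contributes \<open>O(1 / n\<^sup>3)\<close>. Hence
  \<open>\<Phi> n - \<Phi> (n + 1) \<ge> K / n - K / (n + 1)\<close> for each \<open>K\<close> and all large \<open>n\<close>, and telescoping contradicts
  \<open>\<Phi> n \<le> C / n\<close> once \<open>K > C\<close>.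
\<close>

lemma not_tame_0:
  assumes \<alpha>: "0 < \<alpha>" "\<alpha> \<le> 1" and f: "wilton \<alpha> \<in> BMO"
  shows "\<not> tame (wilton \<alpha>) 0"
proof
  let ?f = "wilton \<alpha>"
  note ab = alpha_bar_bounds[OF \<alpha>]
  assume "tame ?f 0"
  then obtain C d where d: "d > 0" "\<And>a b e. 0 < e \<Longrightarrow> e < d \<Longrightarrow> 0 - e \<le> a \<Longrightarrow> b \<le> 0 + e \<Longrightarrow>
     integral {a..b} (\<lambda>x. \<bar>?f x\<bar>) \<le> C * e"
    using tame_subset[OF f] by metis
  have fi: "(\<lambda>x. \<bar>?f x\<bar>) integrable_on {a..b}" for a b by (rule BMO_integrable(2)[OF f])
  define \<Phi> where "\<Phi> n = integral {0..1 / real n} (\<lambda>x. \<bar>?f x\<bar>)" for n :: nat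
  define F where "F = integral {0..\<alpha>} (\<lambda>x. \<bar>?f x\<bar>)"
  have "F \<ge> 0" unfolding F_def by (intro integral_nonneg fi) auto
  have \<Phi>0: "\<Phi> n \<ge> 0" for n unfolding \<Phi>_def by (intro integral_nonneg fi) auto
  have step: "\<Phi> n - \<Phi> (Suc n) \<ge> ln (real n) * (1 / real n - 1 / (real n + \<alpha>)) - F / real n ^ 3" if n: "n \<ge> 3" for n
  proof -
    let ?S = "{1 / (real n + \<alpha>)..1 / real n}"
    define g where "g x = 1 / x - real n" for x
    have S: "0 < 1 / (real n + \<alpha>)" "1 / (real n + \<alpha>) \<le> 1 / real n" "1 / (real n + 1) \<le> 1 / (real n + \<alpha>)"
      using \<alpha> n by (auto intro!: divide_left_mono)
    have nab: "1 / real n < alpha_bar \<alpha>"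
    proof -
      have "1 / real n \<le> 1 / 3" using n by (intro divide_left_mono) auto
      moreover have "1 / 2 \<le> alpha_bar \<alpha>" by (auto simp: alpha_bar_def max_def)
      ultimately show ?thesis by linarith
    qed
    \<comment> \<open>At the left endpoint the branch of \<open>A\<close> is already the next one.\<close>
    define N where "N = insert (1 / (real n + \<alpha>)) {y. 0 < y \<and> y < alpha_bar \<alpha> \<and> \<not> summable (wilton_term \<alpha> y)}"
    have N: "negligible N" unfolding N_def using negligible_nonsummable[OF \<alpha>] by simp
    have img: "g ` ?S = {0..\<alpha>}"
      using image_inverse_shift(1)[OF S(1,2), of "real n"] by (simp add: g_def[abs_def])
    have der: "(g has_field_derivative (- (1 / x\<^sup>2))) (at x within ?S)" if "x \<in> ?S" for x
      using that S(1) unfolding g_def by (intro inverse_shift_has_field_derivative) auto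
    have inj: "inj_on g ?S" unfolding g_def inj_on_def by auto
    have ai: "(\<lambda>x. \<bar>?f x\<bar>) absolutely_integrable_on g ` ?S"
      unfolding img using set_integrable_abs[OF BMO_absolutely_integrable[OF f]] by auto
    note sub = absolutely_integrable_substitution[OF ai der inj]
    have hi: "(\<lambda>x. 1 / real n ^ 3 * (\<bar>- (1 / x\<^sup>2)\<bar> * \<bar>?f (g x)\<bar>)) integrable_on ?S"
      using sub(1) by (rule integrable_on_mult_right)
    have "ln (real n) * (1 / real n - 1 / (real n + \<alpha>)) - F / real n ^ 3
        = integral ?S (\<lambda>x. ln (real n) - 1 / real n ^ 3 * (\<bar>- (1 / x\<^sup>2)\<bar> * \<bar>?f (g x)\<bar>))"
      unfolding Henstock_Kurzweil_Integration.integral_diff[OF integrable_const_ivl hi]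
        Henstock_Kurzweil_Integration.integral_mult_right using S(2) sub(2) by (simp add: img F_def)
    also have "\<dots> \<le> integral ?S (\<lambda>x. \<bar>?f x\<bar>)"
    proof (rule integral_le_off_negligible[OF N _ fi])
      show "(\<lambda>x. ln (real n) - 1 / real n ^ 3 * (\<bar>- (1 / x\<^sup>2)\<bar> * \<bar>?f (g x)\<bar>)) integrable_on ?S"
        using hi by (intro integrable_diff) auto
      fix x assume x: "x \<in> ?S - N"
      then have x': "1 / (real n + \<alpha>) < x" "x \<le> 1 / real n" "0 < x" "x < alpha_bar \<alpha>"
      proof -
        show "0 < x" using x S(1) by (meson DiffD1 atLeastAtMost_iff less_le_trans)
      qed (use x nab in \<open>auto simp: N_def\<close>)
      have inv: "real n \<le> 1 / x" "1 / x < real n + \<alpha>" using x' n \<alpha> by (auto simp: field_simps)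
      have "cf_map \<alpha> x = \<bar>1 / x - of_int (int n)\<bar>"
        using x' inv \<alpha> by (intro cf_map_eq) auto
      then have Ax: "cf_map \<alpha> x = g x" "0 \<le> g x" "g x < alpha_bar \<alpha>"
        using inv ab unfolding g_def by auto
      have "summable (wilton_term \<alpha> x)" using x x' by (auto simp: N_def)
      then have "?f x = - ln x - x * ?f (g x)"
        using summable_wilton_term_shift(2)[of x \<alpha>] x' Ax wilton_left[of "g x" \<alpha>] wilton_left[of x \<alpha>] ab by simp
      then have "- ln x - \<bar>x * ?f (g x)\<bar> \<le> \<bar>?f x\<bar>" by linarith
      moreover have "\<bar>x * ?f (g x)\<bar> = x ^ 3 * (\<bar>- (1 / x\<^sup>2)\<bar> * \<bar>?f (g x)\<bar>)"
        using x' by (simp add: abs_mult power2_eq_square power3_eq_cube)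
      moreover have "x ^ 3 * (\<bar>- (1 / x\<^sup>2)\<bar> * \<bar>?f (g x)\<bar>) \<le> 1 / real n ^ 3 * (\<bar>- (1 / x\<^sup>2)\<bar> * \<bar>?f (g x)\<bar>)"
        using power_mono[OF x'(2), of 3] x' by (intro mult_right_mono) (auto simp: power_divide)
      moreover have "ln (real n) \<le> - ln x"
        using inv n x' ln_mono[of "real n" "1 / x"] by (simp add: ln_div)
      ultimately show "ln (real n) - 1 / real n ^ 3 * (\<bar>- (1 / x\<^sup>2)\<bar> * \<bar>?f (g x)\<bar>) \<le> \<bar>?f x\<bar>" by linarith
    qed
    also have "\<dots> \<le> integral {1 / real (Suc n)..1 / real n} (\<lambda>x. \<bar>?f x\<bar>)"
      using S by (intro integral_subset_le fi) (auto simp: add.commute)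
    also have "\<dots> = \<Phi> n - \<Phi> (Suc n)"
    proof -
      have "\<Phi> (Suc n) + integral {1 / real (Suc n)..1 / real n} (\<lambda>x. \<bar>?f x\<bar>) = \<Phi> n"
        unfolding \<Phi>_def using n fi by (intro Henstock_Kurzweil_Integration.integral_combine) (auto intro!: divide_left_mono)
      then show ?thesis by simp
    qed
    finally show ?thesis .
  qed
  define K where "K = \<bar>C\<bar> + 1"
  obtain n0 :: nat where n0: "real n0 > max 3 (max (1 / d) (exp ((K + 2 * F) / \<alpha>)))"
    using reals_Archimedean2 by blast
  have step': "\<Phi> n - \<Phi> (Suc n) \<ge> K / real n - K / real (Suc n)" if "n \<ge> n0" for n
  proof -
    have n: "real n > 3" "real n > exp ((K + 2 * F) / \<alpha>)" using that n0 by auto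
    have "(K + 2 * F) / \<alpha> \<le> ln (real n)" using n by (subst ln_ge_iff) auto
    then have l: "K + 2 * F \<le> \<alpha> * ln (real n)" using \<alpha> by (simp add: field_simps)
    have "K / real n - K / real (Suc n) = K / (real n * (real n + 1))" using n by (simp add: field_simps)
    also have "\<dots> \<le> (\<alpha> * ln (real n) - 2 * F) / (real n * (real n + 1))" using l n by (intro divide_right_mono) auto
    also have "\<dots> = \<alpha> * ln (real n) / (real n * (real n + 1)) - 2 * F / (real n * (real n + 1))"
      by (simp add: diff_divide_distrib)
    also have "\<dots> \<le> \<alpha> * ln (real n) / (real n * (real n + \<alpha>)) - F / real n ^ 3"
    proof (intro diff_mono)
      show "\<alpha> * ln (real n) / (real n * (real n + 1)) \<le> \<alpha> * ln (real n) / (real n * (real n + \<alpha>))"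
        using n \<alpha> by (intro divide_left_mono mult_left_mono mult_pos_pos mult_nonneg_nonneg) auto
      have "F * (real n * (real n + 1)) \<le> 2 * F * real n ^ 3"
      proof -
        have "real n * 1 \<le> real n * real n" using n(1) by (intro mult_left_mono) auto
        then have "real n + 1 \<le> 2 * (real n * real n)" using n(1) by linarith
        then have "F * real n * (real n + 1) \<le> F * real n * (2 * (real n * real n))" using \<open>F \<ge> 0\<close> by (intro mult_left_mono) auto
        then show ?thesis by (simp add: power3_eq_cube algebra_simps)
      qed
      then show "F / real n ^ 3 \<le> 2 * F / (real n * (real n + 1))"
        using n by (subst frac_le_eq) (auto simp: divide_nonpos_pos)
    qed
    also have "\<dots> = ln (real n) * (1 / real n - 1 / (real n + \<alpha>)) - F / real n ^ 3"
      using n \<alpha> by (simp add: field_simps)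
    also have "\<dots> \<le> \<Phi> n - \<Phi> (Suc n)" using n by (intro step) auto
    finally show ?thesis .
  qed
  have tele: "\<Phi> n0 - \<Phi> (n0 + k) \<ge> K / real n0 - K / real (n0 + k)" for k
  proof (induction k)
    case (Suc k)
    then show ?case using step'[of "n0 + k"] by simp
  qed simp
  obtain k :: nat where k: "real k > K * real n0" using reals_Archimedean2 by blast
  have "\<Phi> n0 \<le> C * (1 / real n0)" unfolding \<Phi>_def
    using n0 d(1) by (intro d(2)) (auto simp: field_simps)
  then have "K / real n0 - K / real (n0 + k) \<le> \<bar>C\<bar> / real n0"
    using tele[of k] \<Phi>0[of "n0 + k"] divide_right_mono[OF abs_ge_self, of "real n0" C] by auto
  then have "1 / real n0 \<le> K / real (n0 + k)" by (simp add: K_def add_divide_distrib)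
  then have "real (n0 + k) \<le> K * real n0" using n0 by (simp add: field_simps)
  with k show False by simp
qed

text \<open>
  Descent on the denominator: \<open>A\<close> maps \<open>p / q\<close> to a fraction with denominator \<open>p\<close>.
\<close>

lemma not_tame_rational:
  assumes \<alpha>: "0 < \<alpha>" "\<alpha> \<le> 1" and f: "wilton \<alpha> \<in> BMO"
    and r: "r \<in> \<rat>" "0 \<le> r" "r \<le> alpha_bar \<alpha>"
  shows "\<not> tame (wilton \<alpha>) r"
proof -
  note ab = alpha_bar_bounds[OF \<alpha>]
  have *: "\<not> tame (wilton \<alpha>) (real p / real q)" if "q > 0" "real p / real q \<le> alpha_bar \<alpha>" for p q :: nat
    using that
  proof (induction q arbitrary: p rule: less_induct)
    case (less q)
    show ?case
    proof
      assume t: "tame (wilton \<alpha>) (real p / real q)"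
      have p: "p > 0" using t not_tame_0[OF \<alpha> f] by (cases p) auto
      define r where "r = real p / real q"
      have r: "0 < r" "r \<le> alpha_bar \<alpha>" using p less.prems by (auto simp: r_def)
      have t': "tame (wilton \<alpha>) (cf_map \<alpha> r)" using tame_cf_map[OF \<alpha> f _ r] t by (simp add: r_def)
      have "real p / real q \<le> 1" using r ab by (simp add: r_def)
      then have "p \<le> q" using less.prems by simp
      define n where "n = \<lfloor>1 / r + 1 - \<alpha>\<rfloor>"
      have "cf_map \<alpha> r = \<bar>real q / real p - of_int n\<bar>"
        using r by (simp add: cf_map_def n_def) (simp add: r_def)
      also have "\<dots> = \<bar>of_int (int q - n * int p)\<bar> / real p"
        using p by (simp add: field_simps abs_divide[symmetric])
      also have "\<dots> = real (nat \<bar>int q - n * int p\<bar>) / real p" by (simp add: of_nat_nat)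
      finally have A: "cf_map \<alpha> r = real (nat \<bar>int q - n * int p\<bar>) / real p" .
      show False
      proof (cases "p < q")
        case True
        then show False
          using less.IH[OF True p, of "nat \<bar>int q - n * int p\<bar>"] t' cf_map_range(2)[OF \<alpha>, of r] unfolding A by blast
      next
        case False
        then have "r = 1" using \<open>p \<le> q\<close> p by (simp add: r_def)
        then have "alpha_bar \<alpha> = 1" using r ab by simp
        then have "\<alpha> = 1" using \<alpha> by (auto simp: alpha_bar_def max_def split: if_splits)
        then have "cf_map \<alpha> r = 0" by (simp add: cf_map_def \<open>r = 1\<close>)
        then show False using t' not_tame_0[OF \<alpha> f] by simp
      qed
    qed
  qed
  from r(1) obtain m n where mn: "n \<noteq> 0" "\<bar>r\<bar> = real m / real n" by (rule Rats_abs_nat_div_natE)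
  with *[of n m] r show ?thesis by simp
qed

section \<open>A criterion for unbounded mean oscillation\<close>

text \<open>
  With \<open>a = alpha_bar \<alpha>\<close> and \<open>b = 1 - a\<close>, the hypothesis bounds \<open>W (a - s) + W (b + s)\<close> for small \<open>s > 0\<close>. Moreover
  \<open>W (a + s)\<close> equals \<open>W (b - s)\<close> if \<open>a < 1\<close>, and \<open>W (b + s)\<close> if \<open>a = 1\<close>; in either case the averages to the left of
  \<open>a\<close> and to the right of \<open>b\<close> differ by a bounded amount.
\<close>

lemma wilton_notin_BMO:
  assumes \<alpha>: "0 < \<alpha>" "\<alpha> \<le> 1" "\<alpha> \<noteq> 1 / 2" "\<alpha> \<in> \<rat>"
    and d: "0 < d"
    and C: "\<And>t. 1 - alpha_bar \<alpha> < t \<Longrightarrow> t < 1 - alpha_bar \<alpha> + d \<Longrightarrow>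
      summable (wilton_term \<alpha> t) \<Longrightarrow> summable (wilton_term \<alpha> (1 - t)) \<Longrightarrow> \<bar>wilton_series \<alpha> (1 - t) + wilton_series \<alpha> t\<bar> \<le> C"
  shows "wilton \<alpha> \<notin> BMO"
proof
  let ?f = "wilton \<alpha>"
  assume f: "?f \<in> BMO"
  note ab = alpha_bar_bounds[OF \<alpha>(1,2)]
  define a b where "a = alpha_bar \<alpha>" and "b = 1 - a"
  have a: "1 / 2 < a" "a \<le> 1" using \<alpha> by (auto simp: a_def alpha_bar_def max_def)
  have b: "0 \<le> b" "b < a" using a by (auto simp: b_def)
  define E where "E = {y. 0 < y \<and> y < a \<and> \<not> summable (wilton_term \<alpha> y)}"
  define N where "N = (\<lambda>x. a - x) ` E \<union> (\<lambda>x. x - b) ` E \<union> {0}"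
  have E: "negligible E" unfolding E_def a_def by (rule negligible_nonsummable[OF \<alpha>(1,2)])
  have N: "negligible N"
  proof -
    have "negligible ((\<lambda>x. a - x) ` E)" "negligible ((\<lambda>x. x - b) ` E)"
      by (rule negligible_differentiable_image_negligible[OF _ E], simp, intro derivative_intros)+
    then show ?thesis unfolding N_def by simp
  qed
  obtain K where K: "\<And>c e. e > 0 \<Longrightarrow> \<bar>integral {c - e..c} ?f - integral {c..c + e} ?f\<bar> \<le> K * e"
    using BMO_adjacent_intervals[OF f] by metis
  define d' where "d' = Min {d, a - b, if a = 1 then 1 else b}"
  have d': "0 < d'" "d' \<le> d" "d' \<le> a - b" "d' \<le> (if a = 1 then 1 else b)"
    using d a b by (auto simp: d'_def b_def)
  have tame: "tame ?f a"
  proof (rule BMO_tame[OF f d'(1)])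
    fix e assume e: "0 < e" "e < d'"
    note rec = BMO_integral_recentre[OF f less_imp_le[OF e(1)]]
    have sum: "\<bar>integral {a - e..a} ?f + integral {b..b + e} ?f\<bar> \<le> C * e"
    proof -
      have pw: "\<bar>?f (a - s) + ?f (b + s)\<bar> \<le> C" if s: "s \<in> {0..e} - N" for s
      proof -
        have s': "0 < s" "s \<le> e" using s by (auto simp: N_def order_less_le)
        have st: "1 - (b + s) = a - s" "0 < b + s" "b + s < a" "0 < a - s" "a - s < a"
          using s' e d' b a by (auto simp: b_def)
        have "a - s \<notin> E" "b + s \<notin> E" using s by (auto simp: N_def image_iff)
        then have "summable (wilton_term \<alpha> (b + s))" "summable (wilton_term \<alpha> (1 - (b + s)))"
          unfolding st(1) using st(2-) by (auto simp: E_def)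
        then have "\<bar>wilton_series \<alpha> (1 - (b + s)) + wilton_series \<alpha> (b + s)\<bar> \<le> C"
          using s' e d' by (intro C) (assumption | simp add: b_def a_def)+
        then show ?thesis using st wilton_left[of "a - s" \<alpha>] wilton_left[of "b + s" \<alpha>] ab by (simp add: a_def)
      qed
      have int: "(\<lambda>s. ?f (a - s) + ?f (b + s)) integrable_on {0..e}" using rec(1,3) by (rule integrable_add[rotated])
      have eq: "integral {a - e..a} ?f + integral {b..b + e} ?f = integral {0..e} (\<lambda>s. ?f (a - s) + ?f (b + s))"
        using Henstock_Kurzweil_Integration.integral_add[OF rec(3)[of a] rec(1)[of b]] rec(2,4) by simp
      have "integral {0..e} (\<lambda>s. ?f (a - s) + ?f (b + s)) \<le> integral {0..e} (\<lambda>s. C)"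
      proof (rule integral_le_off_negligible[OF N int])
        show "?f (a - s) + ?f (b + s) \<le> C" if "s \<in> {0..e} - N" for s using pw[OF that] by linarith
      qed (rule integrable_const_ivl)
      moreover have "integral {0..e} (\<lambda>s. - C) \<le> integral {0..e} (\<lambda>s. ?f (a - s) + ?f (b + s))"
      proof (rule integral_le_off_negligible[OF N _ int])
        show "- C \<le> ?f (a - s) + ?f (b + s)" if "s \<in> {0..e} - N" for s using pw[OF that] by linarith
      qed (rule integrable_const_ivl)
      ultimately show ?thesis using e unfolding eq by (simp add: abs_le_iff mult.commute)
    qed
    have dis: "integral {a..a + e} ?f = integral {b - e..b} ?f \<or> integral {a..a + e} ?f = integral {b..b + e} ?f"
    proof (cases "a = 1")
      case True
      have "?f (a + s) = ?f (b + s)" if "s \<in> {0..e} - {}" for s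
        using that e d' True wilton_right[of \<alpha> "a + s"] wilton_left[of "b + s" \<alpha>] by (simp add: a_def b_def)
      then have "integral {0..e} (\<lambda>s. ?f (a + s)) = integral {0..e} (\<lambda>s. ?f (b + s))" by (intro integral_cong) auto
      then show ?thesis using rec(2) by simp
    next
      case False
      have "?f (a + s) = ?f (b - s)" if "s \<in> {0..e}" for s
      proof -
        have s: "0 \<le> s" "s < b" using that e d' False by auto
        have "?f (a + s) = wilton_series \<alpha> \<bar>a + s - 1\<bar>" using s a b wilton_right[of \<alpha> "a + s"] by (simp add: a_def)
        also have "\<bar>a + s - 1\<bar> = b - s" using s by (simp add: b_def)
        also have "wilton_series \<alpha> (b - s) = ?f (b - s)" using s a b wilton_left[of "b - s" \<alpha>] by (simp add: a_def)
        finally show ?thesis .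
      qed
      then have "integral {0..e} (\<lambda>s. ?f (a + s)) = integral {0..e} (\<lambda>s. ?f (b - s))" by (intro integral_cong) auto
      then show ?thesis using rec(2,4) by simp
    qed
    have "\<bar>integral {a - e..a} ?f - integral {b..b + e} ?f\<bar> \<le> 2 * (\<bar>K\<bar> * e)"
    proof -
      have "K * e \<le> \<bar>K\<bar> * e" using e by (intro mult_right_mono) auto
      then show ?thesis using dis K[OF e(1), of a] K[OF e(1), of b] by linarith
    qed
    then have "\<bar>integral {a - e..a} ?f\<bar> \<le> (C * e) / 2 + \<bar>K\<bar> * e" using sum by linarith
    then have "\<bar>integral {a - e..a} ?f\<bar> \<le> (C / 2 + \<bar>K\<bar>) * e" by (simp add: algebra_simps)
    then show "\<bar>integral {a - e..a} ?f\<bar> \<le> (C / 2 + \<bar>K\<bar>) * e \<or> \<bar>integral {a..a + e} ?f\<bar> \<le> (C / 2 + \<bar>K\<bar>) * e" ..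
  qed
  have "a \<in> \<rat>" using \<alpha>(4) by (auto simp: a_def alpha_bar_def max_def)
  then show False using not_tame_rational[OF \<alpha>(1,2) f, of a] tame a ab by (simp add: a_def)
qed

section \<open>Parameters above the golden mean\<close>

lemma cf_map_shift:
  assumes "x \<noteq> 0" "y \<noteq> 0" "1 / x = 1 / y + of_int k"
  shows "cf_map \<alpha> x = cf_map \<alpha> y"
proof -
  have "1 / x + 1 - \<alpha> = (1 / y + 1 - \<alpha>) + of_int k" using assms by simp
  then have "\<lfloor>1 / x + 1 - \<alpha>\<rfloor> = \<lfloor>1 / y + 1 - \<alpha>\<rfloor> + k" by (metis floor_add_int)
  then show ?thesis using assms by (simp add: cf_map_def)
qed

text \<open>
  For \<open>\<alpha>\<close> above the golden mean \<open>1 / (1 + \<alpha>) < \<alpha>\<close>, so a point \<open>x = 1 - t\<close> slightly below \<open>\<alpha>\<close> satisfies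
  \<open>A x = 1 / x - 1 = t / x\<close>. The reciprocal of this is \<open>1 / t - 1\<close>, hence \<open>A (A x) = A t\<close>.
\<close>

lemma wilton_notin_BMO_gt_golden:
  assumes "(sqrt 5 - 1) / 2 < \<alpha>" "\<alpha> \<le> 1" "\<alpha> \<in> \<rat>"
  shows "wilton \<alpha> \<notin> BMO"
proof -
  have s5: "2 < sqrt 5" by (rule real_less_rsqrt) simp
  have \<alpha>: "1 / 2 < \<alpha>" "0 < \<alpha>" "\<alpha> \<noteq> 1 / 2" using assms s5 by auto
  have bar: "alpha_bar \<alpha> = \<alpha>" using \<alpha> by (simp add: alpha_bar_def)
  have "sqrt 5 < 2 * \<alpha> + 1" using assms(1) by simp
  then have "(sqrt 5)\<^sup>2 < (2 * \<alpha> + 1)\<^sup>2" by (intro power_strict_mono) auto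
  then have "1 < \<alpha> * (1 + \<alpha>)" by (simp add: power2_eq_square algebra_simps)
  then have d: "0 < \<alpha> - 1 / (1 + \<alpha>)" using \<alpha> by (simp add: field_simps)
  show ?thesis
  proof (rule wilton_notin_BMO[OF \<alpha>(2) assms(2) \<alpha>(3) assms(3) d])
    fix t assume t0: "1 - alpha_bar \<alpha> < t" "t < 1 - alpha_bar \<alpha> + (\<alpha> - 1 / (1 + \<alpha>))"
      and sum: "summable (wilton_term \<alpha> t)" "summable (wilton_term \<alpha> (1 - t))"
    define x where "x = 1 - t"
    have "1 / 2 \<le> 1 / (1 + \<alpha>)" using \<alpha> assms by (intro divide_left_mono) auto
    then have x: "1 / (1 + \<alpha>) < x" "x < \<alpha>" "1 / 2 < x" "x < 1" "t = 1 - x" "0 < t" "t < 1 / 2"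
      using t0 assms by (auto simp: bar x_def)
    define y where "y = t / x"
    have y: "0 < y" "x * y = t" using x by (auto simp: y_def)
    have "1 < 1 / x" "1 / x < 1 + \<alpha>" using x \<alpha> by (auto simp: field_simps)
    then have "cf_map \<alpha> x = \<bar>1 / x - of_int 1\<bar>" using x assms by (intro cf_map_eq) linarith+
    also have "\<dots> = y" using x by (simp add: y_def field_simps)
    finally have Ax: "cf_map \<alpha> x = y" .
    have Ay: "cf_map \<alpha> y = cf_map \<alpha> t"
      using x y by (intro cf_map_shift[of _ _ "-1"]) (auto simp: y_def field_simps)
    have wt: "wilton_series \<alpha> t = - ln t - t * wilton_series \<alpha> (cf_map \<alpha> t)"
      using summable_wilton_term_shift(2)[OF _ sum(1)] x by simp
    have wx: "wilton_series \<alpha> x = - ln x - x * wilton_series \<alpha> y" and sy: "summable (wilton_term \<alpha> y)"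
      using summable_wilton_term_shift[of x \<alpha>] sum(2) x by (simp_all add: Ax flip: x_def)
    have wy: "wilton_series \<alpha> y = - ln y - y * wilton_series \<alpha> (cf_map \<alpha> t)"
      using summable_wilton_term_shift(2)[OF _ sy] y by (simp add: Ay)
    have "wilton_series \<alpha> x + wilton_series \<alpha> t = - ln x + x * ln y + (x * y) * wilton_series \<alpha> (cf_map \<alpha> t) - ln t - t * wilton_series \<alpha> (cf_map \<alpha> t)"
      unfolding wx wy wt by (simp add: algebra_simps)
    also have "\<dots> = - ln x + x * ln y - ln t" by (simp add: y(2))
    also have "ln y = ln t - ln x" using x by (simp add: y_def ln_div)
    also have "- ln x + x * (ln t - ln x) - ln t = (1 + x) * (- ln x) + t * (- ln t)"
      by (simp add: x(5) algebra_simps)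
    finally have eq: "wilton_series \<alpha> x + wilton_series \<alpha> t = (1 + x) * (- ln x) + t * (- ln t)" .
    have inv: "- ln z = ln (1 / z)" if "z > 0" for z :: real using that by (simp add: ln_div)
    have "- ln x \<le> 1"
    proof -
      have "1 / x \<le> 2" using x by (simp add: field_simps)
      then show ?thesis using ln_le_minus_one[of "1 / x"] inv[of x] x by simp
    qed
    moreover have "0 \<le> - ln x" "0 \<le> - ln t" using x by auto
    moreover have "t * (- ln t) \<le> 1" using ln_bound[of "1 / t"] inv[of t] x(6) by (simp add: field_simps)
    moreover have "(1 + x) * (- ln x) \<le> 2 * 1" using x calculation by (intro mult_mono) auto
    moreover have "0 \<le> (1 + x) * (- ln x)" "0 \<le> t * (- ln t)" using x calculation by (intro mult_nonneg_nonneg; simp)+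
    ultimately have "\<bar>wilton_series \<alpha> x + wilton_series \<alpha> t\<bar> \<le> 3" unfolding eq by linarith
    then show "\<bar>wilton_series \<alpha> (1 - t) + wilton_series \<alpha> t\<bar> \<le> 3" by (simp add: x_def)
  qed
qed

section \<open>Parameters increasing to the square of the golden mean\<close>

text \<open>
  With \<open>N z = (1 - 2 z) / (1 - z)\<close>, the difference \<open>(1 - z) w (N z) - w z\<close> is bounded near \<open>z0\<close>, at the points
  where both series converge. This is what remains if the orbits of \<open>z\<close> and \<open>N z\<close> merge after
  numbers of steps of the same parity: the common tail cancels, the factor \<open>1 - z\<close> making its two
  coefficients equal.
\<close>

definition matched_near :: "real \<Rightarrow> real \<Rightarrow> bool" where
  "matched_near \<alpha> z0 \<longleftrightarrow> (\<exists>C d. d > 0 \<and> (\<forall>z. \<bar>z - z0\<bar> < d \<longrightarrow> summable (wilton_term \<alpha> z) \<longrightarrow>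
     summable (wilton_term \<alpha> ((1 - 2 * z) / (1 - z))) \<longrightarrow>
     \<bar>(1 - z) * wilton_series \<alpha> ((1 - 2 * z) / (1 - z)) - wilton_series \<alpha> z\<bar> \<le> C))"

lemma abs_mult_ln_le:
  fixes c x :: real
  assumes "1 / 10 \<le> x" "x \<le> 1" "0 \<le> c" "c \<le> 1"
  shows "\<bar>c * ln x\<bar> \<le> 9"
proof -
  have "ln (1 / x) \<le> 1 / x - 1" using assms by (intro ln_le_minus_one) auto
  moreover have "1 / x \<le> 10" using assms by (simp add: field_simps)
  moreover have "ln (1 / x) = - ln x" using assms by (simp add: ln_div)
  moreover have "ln x \<le> 0" using assms by simp
  ultimately have "\<bar>ln x\<bar> \<le> 9" by linarith
  then show ?thesis using assms mult_mono[of c 1 "\<bar>ln x\<bar>" 9] by (simp add: abs_mult)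
qed

text \<open>
  Near \<open>5 / 14\<close> the orbits continue with \<open>v = 3 - 1 / z\<close> and \<open>v' = 1 / w - 2\<close>, where \<open>w = N z\<close>. Their reciprocals differ by exactly
  \<open>1\<close>, so they have the same image.
\<close>

lemma matched_near_base:
  assumes \<alpha>: "5 / 14 \<le> \<alpha>" "\<alpha> < 2 / 5"
  shows "matched_near \<alpha> (5 / 14)"
proof -
  \<comment> \<open>The radius fixes the branches of all points involved and keeps these points above \<open>1 / 10\<close>, so that each\<close>
  \<comment> \<open>of the four logarithms that remain contributes at most \<open>9\<close>.\<close>
  have "\<bar>(1 - z) * wilton_series \<alpha> ((1 - 2 * z) / (1 - z)) - wilton_series \<alpha> z\<bar> \<le> 36"
    if z0: "\<bar>z - 5 / 14\<bar> < 1 / 500" and sum: "summable (wilton_term \<alpha> z)" "summable (wilton_term \<alpha> ((1 - 2 * z) / (1 - z)))" for z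
  proof -
    have z: "7 / 20 < z" "z < 9 / 25" using z0 unfolding abs_less_iff by linarith+
    define w v v' where "w = (1 - 2 * z) / (1 - z)" and "v = (3 * z - 1) / z" and "v' = (3 * z - 1) / (1 - 2 * z)"
    have w: "1 / 10 \<le> w" "w \<le> 1" "1 / w = (1 - z) / (1 - 2 * z)" and v: "1 / 10 \<le> v" "v \<le> 1" and v': "1 / 10 \<le> v'" "v' \<le> 1"
      using z by (auto simp: w_def v_def v'_def field_simps)
    have "cf_map \<alpha> z = \<bar>1 / z - of_int 3\<bar>"
    proof (rule cf_map_eq)
      have "1 / z < 20 / 7" "25 / 9 < 1 / z" using z by (auto simp: field_simps)
      then show "of_int 3 \<le> 1 / z + 1 - \<alpha>" "1 / z + 1 - \<alpha> < of_int 3 + 1" using \<alpha> by auto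
    qed (use z in auto)
    also have "\<dots> = v" using z by (simp add: v_def field_simps)
    finally have Az: "cf_map \<alpha> z = v" .
    have "cf_map \<alpha> w = \<bar>1 / w - of_int 2\<bar>"
    proof (rule cf_map_eq)
      have "2 < 1 / w" "1 / w < 7 / 3" unfolding w(3) using z by (auto simp: field_simps)
      then show "of_int 2 \<le> 1 / w + 1 - \<alpha>" "1 / w + 1 - \<alpha> < of_int 2 + 1" using \<alpha> by auto
    qed (use w in auto)
    also have "\<dots> = v'" unfolding w(3) using z by (simp add: v'_def field_simps)
    finally have Aw: "cf_map \<alpha> w = v'" .
    have Av: "cf_map \<alpha> v = cf_map \<alpha> v'"
      using z by (intro cf_map_shift[of _ _ 1]) (auto simp: v_def v'_def field_simps)
    have wz: "wilton_series \<alpha> z = - ln z - z * wilton_series \<alpha> v" and sv: "summable (wilton_term \<alpha> v)"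
      using summable_wilton_term_shift[OF _ sum(1)] z by (simp_all add: Az)
    have ww: "wilton_series \<alpha> w = - ln w - w * wilton_series \<alpha> v'" and sv': "summable (wilton_term \<alpha> v')"
      using summable_wilton_term_shift[of w \<alpha>] sum(2) w by (simp_all add: Aw flip: w_def)
    have wv: "wilton_series \<alpha> v = - ln v - v * wilton_series \<alpha> (cf_map \<alpha> v)" using summable_wilton_term_shift(2)[OF _ sv] v by simp
    have wv': "wilton_series \<alpha> v' = - ln v' - v' * wilton_series \<alpha> (cf_map \<alpha> v)" using summable_wilton_term_shift(2)[OF _ sv'] v' by (simp add: Av)
    have zv: "z * v = 3 * z - 1" "(1 - z) * w = 1 - 2 * z" "(1 - 2 * z) * v' = 3 * z - 1"
      using z by (auto simp: v_def w_def v'_def)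
    have "wilton_series \<alpha> z = - ln z + z * ln v + (z * v) * wilton_series \<alpha> (cf_map \<alpha> v)"
      unfolding wz wv by (simp add: algebra_simps)
    moreover have "(1 - z) * wilton_series \<alpha> w = - ((1 - z) * ln w) - ((1 - z) * w) * wilton_series \<alpha> v'"
      unfolding ww by (simp add: algebra_simps)
    moreover have "(1 - 2 * z) * wilton_series \<alpha> v' = - ((1 - 2 * z) * ln v') - ((1 - 2 * z) * v') * wilton_series \<alpha> (cf_map \<alpha> v)"
      unfolding wv' by (simp add: algebra_simps)
    ultimately have "(1 - z) * wilton_series \<alpha> w - wilton_series \<alpha> z = - ((1 - z) * ln w) + (1 - 2 * z) * ln v' + 1 * ln z - z * ln v"
      unfolding zv by simp
    moreover have "\<bar>(1 - z) * ln w\<bar> \<le> 9" "\<bar>(1 - 2 * z) * ln v'\<bar> \<le> 9" "\<bar>1 * ln z\<bar> \<le> 9" "\<bar>z * ln v\<bar> \<le> 9"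
      using z w v v' by (intro abs_mult_ln_le; simp)+
    ultimately show ?thesis unfolding w_def by linarith
  qed
  then show ?thesis unfolding matched_near_def by (intro exI[of _ 36] exI[of _ "1/500"]) auto
qed

text \<open>
  While \<open>z\<close> and \<open>N z\<close> both lie in the branch \<open>M z = 3 - 1 / z\<close> of \<open>A\<close>, the relation \<open>M (N z) = N (M z)\<close> reproduces the
  situation at \<open>M z\<close>.
\<close>

lemma matched_near_step:
  assumes \<alpha>: "5 / 14 \<le> \<alpha>" "\<alpha> < 48 / 125" and z0: "3 / 8 < z0" "z0 < 48 / 125"
    and *: "matched_near \<alpha> (3 - 1 / z0)"
  shows "matched_near \<alpha> z0"
proof -
  obtain C d where d: "d > 0" and C: "\<And>z. \<bar>z - (3 - 1 / z0)\<bar> < d \<Longrightarrow> summable (wilton_term \<alpha> z) \<Longrightarrow>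
     summable (wilton_term \<alpha> ((1 - 2 * z) / (1 - z))) \<Longrightarrow> \<bar>(1 - z) * wilton_series \<alpha> ((1 - 2 * z) / (1 - z)) - wilton_series \<alpha> z\<bar> \<le> C"
    using * unfolding matched_near_def by blast
  \<comment> \<open>Both \<open>z\<close> and \<open>z0\<close> exceed \<open>1 / 3\<close>, so \<open>9\<close> is a Lipschitz constant of \<open>z \<mapsto> 3 - 1 / z\<close>.\<close>
  define d' where "d' = min (d / 9) (min (z0 - 3 / 8) (48 / 125 - z0))"
  have d': "0 < d'" "d' \<le> d / 9" "d' \<le> z0 - 3 / 8" "d' \<le> 48 / 125 - z0"
    using d z0 unfolding d'_def by linarith+
  have "\<bar>(1 - z) * wilton_series \<alpha> ((1 - 2 * z) / (1 - z)) - wilton_series \<alpha> z\<bar> \<le> 18 + C"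
    if zd: "\<bar>z - z0\<bar> < d'" and sum: "summable (wilton_term \<alpha> z)" "summable (wilton_term \<alpha> ((1 - 2 * z) / (1 - z)))" for z
  proof -
    have z: "3 / 8 < z" "z < 48 / 125" using zd d' by (auto simp: abs_less_iff)
    define w y where "w = (1 - 2 * z) / (1 - z)" and "y = 3 - 1 / z"
    have w: "1 / 10 \<le> w" "w \<le> 1" "1 / w = (1 - z) / (1 - 2 * z)"
      using z by (auto simp: w_def field_simps)
    have y: "0 < y" using z by (auto simp: y_def field_simps)
    have "cf_map \<alpha> z = \<bar>1 / z - of_int 3\<bar>"
    proof (rule cf_map_eq)
      have "1 / z < 8 / 3" "125 / 48 < 1 / z" using z by (auto simp: field_simps)
      then show "of_int 3 \<le> 1 / z + 1 - \<alpha>" "1 / z + 1 - \<alpha> < of_int 3 + 1" using \<alpha> by auto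
    qed (use z in auto)
    then have Az: "cf_map \<alpha> z = y" using y by (simp add: y_def)
    have iw: "5 / 2 < 1 / w" "1 / w < 27 / 10" unfolding w(3) using z by (auto simp: field_simps)
    have "cf_map \<alpha> w = \<bar>1 / w - of_int 3\<bar>"
      using iw \<alpha> w(1) by (intro cf_map_eq) linarith+
    then have "cf_map \<alpha> w = 3 - 1 / w" using iw by simp
    also have "\<dots> = (1 - 2 * y) / (1 - y)"
      unfolding w(3) y_def using z by (simp add: field_simps)
    finally have Aw: "cf_map \<alpha> w = (1 - 2 * y) / (1 - y)" .
    have wz: "wilton_series \<alpha> z = - ln z - z * wilton_series \<alpha> y" and sy: "summable (wilton_term \<alpha> y)"
      using summable_wilton_term_shift[OF _ sum(1)] z by (simp_all add: Az)
    have ww: "wilton_series \<alpha> w = - ln w - w * wilton_series \<alpha> ((1 - 2 * y) / (1 - y))" and sw: "summable (wilton_term \<alpha> ((1 - 2 * y) / (1 - y)))"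
      using summable_wilton_term_shift[of w \<alpha>] sum(2) w by (simp_all add: Aw flip: w_def)
    have "(1 - z) * w = z * (1 - y)" using z by (simp add: w_def y_def field_simps)
    then have "(1 - z) * w * wilton_series \<alpha> ((1 - 2 * y) / (1 - y)) = z * ((1 - y) * wilton_series \<alpha> ((1 - 2 * y) / (1 - y)))" by simp
    then have eq: "(1 - z) * wilton_series \<alpha> w - wilton_series \<alpha> z = - ((1 - z) * ln w) + 1 * ln z
        - z * ((1 - y) * wilton_series \<alpha> ((1 - 2 * y) / (1 - y)) - wilton_series \<alpha> y)"
      unfolding ww wz by (simp add: algebra_simps)
    have "\<bar>y - (3 - 1 / z0)\<bar> < d"
    proof -
      have "1 / 9 \<le> z * z0" using mult_mono[of "1/3" z "1/3" z0] z z0 by simp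
      have "y - (3 - 1 / z0) = (z - z0) / (z * z0)" using z z0 by (simp add: y_def field_simps)
      then have "\<bar>y - (3 - 1 / z0)\<bar> = \<bar>z - z0\<bar> / (z * z0)" using z z0 by (simp add: abs_divide abs_mult)
      also have "\<dots> \<le> \<bar>z - z0\<bar> / (1 / 9)" using \<open>1 / 9 \<le> z * z0\<close> by (intro divide_left_mono) auto
      also have "\<dots> < d" using zd d' by simp
      finally show ?thesis .
    qed
    from C[OF this sy sw] have "\<bar>z * ((1 - y) * wilton_series \<alpha> ((1 - 2 * y) / (1 - y)) - wilton_series \<alpha> y)\<bar> \<le> 1 * C"
      unfolding abs_mult using z by (intro mult_mono) auto
    moreover have "\<bar>(1 - z) * ln w\<bar> \<le> 9" "\<bar>1 * ln z\<bar> \<le> 9" using z w by (intro abs_mult_ln_le; simp)+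
    ultimately show ?thesis unfolding w_def[symmetric] eq by linarith
  qed
  then show ?thesis unfolding matched_near_def using d' by (intro exI[of _ "18 + C"] exI[of _ d']) auto
qed

text \<open>
  The parameters: preimages of \<open>5 / 14\<close> under iterates of the branch \<open>z \<mapsto> 3 - 1 / z\<close>. The inverse
  \<open>z \<mapsto> 1 / (3 - z)\<close> is increasing and attracts \<open>5 / 14\<close> to its fixed point \<open>(3 - sqrt 5) / 2\<close>.
\<close>

primrec u_seq :: "nat \<Rightarrow> real" where
  "u_seq 0 = 5 / 14"
| "u_seq (Suc m) = 1 / (3 - u_seq m)"

lemma u_seq_bounds: "5 / 14 \<le> u_seq m" "u_seq m < (3 - sqrt 5) / 2"
proof -
  let ?h = "(3 - sqrt 5) / 2"
  have s5: "2 < sqrt 5" "sqrt 5 < 16 / 7"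
    by (rule real_less_rsqrt, simp, rule real_less_lsqrt, simp_all add: power2_eq_square)
  have h: "?h = 1 / (3 - ?h)"
  proof -
    have "(3 - sqrt 5) * (3 + sqrt 5) = 4" by (simp add: algebra_simps)
    moreover have "0 < 3 + sqrt 5" using s5 by linarith
    ultimately show ?thesis by (simp add: divide_simps)
  qed
  have "5 / 14 \<le> u_seq m \<and> u_seq m < ?h"
  proof (induction m)
    case 0
    then show ?case using s5 by simp
  next
    case (Suc m)
    have "1 / (3 - u_seq m) < 1 / (3 - ?h)" using Suc s5 by (intro divide_strict_left_mono mult_pos_pos) auto
    moreover have "5 / 14 \<le> 1 / (3 - u_seq m)" using Suc s5 by (simp add: field_simps)
    ultimately show ?case using h by simp
  qed
  then show "5 / 14 \<le> u_seq m" "u_seq m < ?h" by auto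
qed

lemma u_seq_less_Suc: "u_seq m < u_seq (Suc m)"
proof -
  have s5: "2 < sqrt 5" by (rule real_less_rsqrt) simp
  have "sqrt 5 < 3 - 2 * u_seq m" using u_seq_bounds(2)[of m] by simp
  then have "(sqrt 5)\<^sup>2 < (3 - 2 * u_seq m)\<^sup>2" by (intro power_strict_mono) auto
  then have "u_seq m * (3 - u_seq m) < 1" by (simp add: power2_eq_square algebra_simps)
  then show ?thesis using u_seq_bounds(2)[of m] s5 by (simp add: pos_less_divide_eq)
qed

lemma u_seq_tendsto: "u_seq \<longlonglongrightarrow> (3 - sqrt 5) / 2"
proof -
  let ?h = "(3 - sqrt 5) / 2"
  have s5: "2 < sqrt 5" by (rule real_less_rsqrt) simp
  have inc: "incseq u_seq" using u_seq_less_Suc by (intro incseq_SucI less_imp_le)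
  obtain L where L: "u_seq \<longlonglongrightarrow> L"
    by (rule incseq_convergent[OF inc, of ?h]) (use less_imp_le[OF u_seq_bounds(2)] in auto)
  have "L \<le> ?h" by (rule LIMSEQ_le_const2[OF L]) (use less_imp_le[OF u_seq_bounds(2)] in auto)
  then have "L < 3" using s5 by (simp add: field_simps)
  have "(\<lambda>m. 1 / (3 - u_seq m)) \<longlonglongrightarrow> 1 / (3 - L)"
    using \<open>L < 3\<close> by (intro tendsto_divide tendsto_diff tendsto_const L) auto
  moreover have "(\<lambda>m. 1 / (3 - u_seq m)) \<longlonglongrightarrow> L" using LIMSEQ_Suc[OF L] by simp
  ultimately have "1 / (3 - L) = L" by (rule LIMSEQ_unique)
  then have "L * (3 - L) = 1" using \<open>L < 3\<close> by (simp add: field_simps)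
  then have "(3 - 2 * L)\<^sup>2 = 5" by (simp add: power2_eq_square algebra_simps)
  moreover have "0 \<le> 3 - 2 * L" using \<open>L \<le> ?h\<close> s5 by simp
  ultimately have "3 - 2 * L = sqrt 5" using real_sqrt_unique[of "3 - 2 * L" 5] by simp
  then have "L = ?h" by simp
  with L show ?thesis by simp
qed

lemma u_seq_less: "u_seq m < 48 / 125"
proof -
  have "2232 / 1000 < sqrt 5" by (rule real_less_rsqrt) (simp add: power2_eq_square)
  moreover have "2 * u_seq m < 3 - sqrt 5" using u_seq_bounds(2)[of m] by simp
  ultimately show ?thesis by linarith
qed

lemma matched_near_u_seq:
  assumes \<alpha>: "5 / 14 \<le> \<alpha>" "\<alpha> < 48 / 125"
  shows "matched_near \<alpha> (u_seq j)"
proof (induction j)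
  case 0
  then show ?case using matched_near_base[of \<alpha>] \<alpha> by simp
next
  case (Suc j)
  have uj: "5 / 14 \<le> u_seq j" "u_seq j < 48 / 125" using u_seq_bounds(1) u_seq_less by blast+
  have "3 - 1 / u_seq (Suc j) = u_seq j" using uj by simp
  with Suc have m: "matched_near \<alpha> (3 - 1 / u_seq (Suc j))" by (simp only:)
  have "3 / 8 < u_seq (Suc j)" using uj by (simp add: pos_less_divide_eq)
  moreover have "u_seq (Suc j) < 48 / 125" by (rule u_seq_less)
  ultimately show ?case by (rule matched_near_step[OF \<alpha> _ _ m])
qed

lemma u_seq_rational: "u_seq m \<in> \<rat>"
  by (induction m) auto

text \<open>
  Here \<open>1 - alpha_bar \<alpha> = \<alpha>\<close>, and \<open>A (1 - t) = 2 - 1 / (1 - t) = N t\<close> for \<open>t\<close> slightly above \<open>\<alpha>\<close>. This one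
  extra step makes the difference of the numbers of steps odd.
\<close>

lemma wilton_u_seq_notin_BMO: "wilton (u_seq m) \<notin> BMO"
proof -
  define \<alpha> where "\<alpha> = u_seq m"
  have \<alpha>: "5 / 14 \<le> \<alpha>" "\<alpha> < 48 / 125" using u_seq_bounds(1) u_seq_less by (auto simp: \<alpha>_def)
  have bar: "alpha_bar \<alpha> = 1 - \<alpha>" using \<alpha> by (simp add: alpha_bar_def)
  obtain C d where d: "d > 0" and C: "\<And>z. \<bar>z - \<alpha>\<bar> < d \<Longrightarrow> summable (wilton_term \<alpha> z) \<Longrightarrow>
     summable (wilton_term \<alpha> ((1 - 2 * z) / (1 - z))) \<Longrightarrow> \<bar>(1 - z) * wilton_series \<alpha> ((1 - 2 * z) / (1 - z)) - wilton_series \<alpha> z\<bar> \<le> C"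
    using matched_near_u_seq[OF \<alpha>, of m] unfolding matched_near_def \<alpha>_def[symmetric] by blast
  have "wilton \<alpha> \<notin> BMO"
  proof (rule wilton_notin_BMO)
    show "0 < \<alpha>" "\<alpha> \<le> 1" "\<alpha> \<noteq> 1 / 2" using \<alpha> by auto
    show "\<alpha> \<in> \<rat>" unfolding \<alpha>_def by (rule u_seq_rational)
    show "0 < min d (1 / 100)" using d by simp
    fix t assume t0: "1 - alpha_bar \<alpha> < t" "t < 1 - alpha_bar \<alpha> + min d (1 / 100)"
      and sum: "summable (wilton_term \<alpha> t)" "summable (wilton_term \<alpha> (1 - t))"
    have t: "\<bar>t - \<alpha>\<bar> < d" "5 / 14 < t" "t < 2 / 5" using t0 \<alpha> by (auto simp: bar)
    have i: "3 / 2 < 1 / (1 - t)" "1 / (1 - t) < 5 / 3" using t by (auto simp: field_simps)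
    have "cf_map \<alpha> (1 - t) = \<bar>1 / (1 - t) - of_int 2\<bar>"
      using i \<alpha> t by (intro cf_map_eq) auto
    also have "\<dots> = 2 - 1 / (1 - t)" using i by simp
    also have "\<dots> = (1 - 2 * t) / (1 - t)" using t by (simp add: field_simps)
    finally have A: "cf_map \<alpha> (1 - t) = (1 - 2 * t) / (1 - t)" .
    have w: "wilton_series \<alpha> (1 - t) = - ln (1 - t) - (1 - t) * wilton_series \<alpha> ((1 - 2 * t) / (1 - t))"
      and s: "summable (wilton_term \<alpha> ((1 - 2 * t) / (1 - t)))"
      using summable_wilton_term_shift[OF _ sum(2)] t by (simp_all add: A)
    have "\<bar>1 * ln (1 - t)\<bar> \<le> 9" using t by (intro abs_mult_ln_le) auto
    then show "\<bar>wilton_series \<alpha> (1 - t) + wilton_series \<alpha> t\<bar> \<le> 9 + C"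
      using C[OF t(1) sum(1) s] unfolding w by linarith
  qed
  then show ?thesis by (simp add: \<alpha>_def)
qed

section \<open>The two non-membership statements\<close>

theorem theorem1p2:
  fixes g :: real
  assumes "g = (sqrt 5 - 1) / 2"
  shows "(\<forall>\<alpha>\<in>{g<..1} \<inter> \<rat>. wilton \<alpha> \<notin> BMO) \<and>
    (\<exists>u :: nat \<Rightarrow> real.
       (\<forall>m. u m \<in> \<rat> \<and> u m \<in> {0<..1}) \<and>
       strict_mono u \<and> u \<longlonglongrightarrow> 1 - g \<and>
       (\<forall>m. wilton (u m) \<notin> BMO))"
proof
  show "\<forall>\<alpha>\<in>{g<..1} \<inter> \<rat>. wilton \<alpha> \<notin> BMO"
    using wilton_notin_BMO_gt_golden assms by auto
  have lim: "1 - g = (3 - sqrt 5) / 2" using assms by (simp add: field_simps)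
  have s5: "2 < sqrt 5" by (rule real_less_rsqrt) simp
  show "\<exists>u :: nat \<Rightarrow> real. (\<forall>m. u m \<in> \<rat> \<and> u m \<in> {0<..1}) \<and>
       strict_mono u \<and> u \<longlonglongrightarrow> 1 - g \<and> (\<forall>m. wilton (u m) \<notin> BMO)"
  proof (intro exI[of _ u_seq] conjI allI)
    show "u_seq m \<in> {0<..1}" for m using u_seq_bounds[of m] s5 by simp
    show "strict_mono u_seq" using u_seq_less_Suc by (rule strict_monoI_Suc)
    show "u_seq \<longlonglongrightarrow> 1 - g" unfolding lim by (rule u_seq_tendsto)
  qed (rule u_seq_rational wilton_u_seq_notin_BMO)+
qed

end
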